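(* Let $\Theta\subset\{1,\dots,6\}^{\mathbb Z}$ be the subshift of finite type consisting of all $\omega$ such that for every $k\in\mathbb Z$, $E_{\omega_k,\omega_{k+1}}=1$, where $$E=\begin{pmatrix}0&1&0&0&1&0\\0&0&1&0&0&1\\1&0&0&1&0&0\\0&0&1&0&0&1\\1&0&0&1&0&0\\0&1&0&0&1&0\end{pmatrix},$$ with the left shift $\sigma$ and the uniform measure $p$ on $\Theta$. There exists a collection of six piecewise-affine expanding maps $S_1,\dots,S_6:S^1\to S^1$ with a common Markov partition $\mathcal B$ generating a map cocycle $\Phi$ over $(\Theta,\sigma)$, with associated Perron--Frobenius cocycle $\mathcal P$, having the following properties for $i=1,\dots,6$: (i) each $S_i$ preserves Lebesgue measure; (ii) $\vartheta(\omega)=\log(1/3)$ for all $\omega\in\Theta$; (iii) the restriction $\mathcal P_i|_{\chi(\mathcal B)}$ of the Perron--Frobenius operator of $S_i$ has no exceptional eigenvalues; (iv) for each $\omega\in\Theta$, $\Lambda(\mathcal P(\omega))$ contains a unique exceptional exponent, namely $\log\frac{1+\sqrt2}{3}$; (v) there exists an Oseledets decomposition for all $\omega\in\Theta$, and the Oseledets subspace $\mathcal W_2(\omega)$ depends only on $\omega_0$.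
   Context: $S^1=\mathbb R/\mathbb Z$, identified with $[0,1)$; $m$ is Lebesgue measure. A map $T:S^1\to S^1$ is an expanding map if there is a finite partition $0=a_0<a_1<\dots<a_M=1$ such that on each $(a_{i-1},a_i)$, $T$ is continuous and extends to a $C^2$ map on $[a_{i-1},a_i]$ with $|DT|>1$; it is piecewise-affine if moreover $DT$ is constant on each $(a_{i-1},a_i)$. Its Perron--Frobenius operator is $\mathcal P f(x)=\sum_{y\in T^{-1}(x)} f(y)/|DT(y)|$. $\mathrm{BV}$ is the Banach space of real $f\in L^\infty(m)$ with $\mathrm{var} f:=\inf\{\mathrm{var}_{S^1} g: g=f \text{ a.e.}\}<\infty$, with norm $\|f\|=\max\{\|f\|_{L^1},\mathrm{var} f\}$. A partition $\mathcal B=\{B_1,\dots,B_M\}$ of $S^1$ into intervals is a Markov partition for $T$ if $B_i\cap T(B_j)\ne\emptyset$ implies $B_i\subset T(B_j)$; common Markov partition means Markov for each member of the family. $\chi(\mathcal B)$ is the space of functions constant on each $B_k$. For maps $\{S_i\}_{i\in Z_K}$ and a shift-invariant $\Omega\subset Z_K^{\mathbb Z}$ with left shift $(\sigma\omega)_k=\omega_{k+1}$, the map cocycle is $\Phi^{(n)}(\omega)=S_{\omega_{n-1}}\circ\cdots\circ S_{\omega_0}$ and the Perron--Frobenius cocycle is $\mathcal P^{(n)}(\omega)=\mathcal P_{\omega_{n-1}}\cdots\mathcal P_{\omega_0}$ on $\mathrm{BV}$. Lyapunov exponent: $\lambda(\omega,f)=\limsup_{n\to\infty}\frac1n\log\|\mathcal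 P^{(n)}(\omega)f\|$; Lyapunov spectrum $\Lambda(\mathcal P(\omega))=\{\lambda(\omega,f):f\in\mathrm{BV}\}$. Essential upper bound: $\vartheta(\omega)=-\inf_{x}\limsup_{n}\frac1n\log|D\Phi^{(n)}(\omega)(x)|$. Exceptional Lyapunov exponents are elements of $\Lambda(\mathcal P(\omega))$ in $(\vartheta(\omega),0)$. For a single expanding map $T$ with operator $\mathcal P$ on $\mathrm{BV}$, $\theta=\lim_n\sup_x|D(T^n)(x)|^{-1/n}$; an eigenvalue of $\mathcal P$ is exceptional if it differs from $1$ and has modulus $>\theta$. Oseledets decomposition: writing $f\in\chi(\mathcal B)$ as $\langle v\rangle=\sum_k v_k\chi_{B_k}$, $v\in\mathbb R^M$, the cocycle $\mathcal P(\omega)|_{\chi(\mathcal B)}$ is represented by a matrix cocycle $A(\omega)$ on $\mathbb R^M$; an Oseledets decomposition at $\omega$ is a splitting $\mathbb R^M=\bigoplus_{j=1}^\ell W_j(\omega)$ with $A(\omega)W_j(\omega)\subseteq W_j(\sigma\omega)$ (equality if $\lambda_j>-\infty$) and $\lim_n\frac1n\log\|A(\sigma^{n-1}\omega)\cdots A(\omega)v\|=\lambda_j$ for $v\in W_j(\omega)\setminus\{0\}$, where $\lambda_1>\cdots>\lambda_\ell$; $\mathcal W_j(\omega)=\{\langle v\rangle:v\in W_j(\omega)\}$, and $\mathcal W_2(\omega)$ corresponds to the second largest exponent. *)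

theory Defs
  imports "HOL-Analysis.Analysis"
begin

text \<open>S^1 = R/Z is identified with [0,1); points are reals in {0..<1}, the projection
  R -> S^1 is frac. Lebesgue measure m on S^1 is lborel restricted to [0,1).\<close>

definition leb1 :: "real measure" where
  "leb1 = restrict_space lborel {0..<1}"

definition preserves_leb :: "(real \<Rightarrow> real) \<Rightarrow> bool" where
  "preserves_leb T \<longleftrightarrow> T \<in> measurable leb1 leb1 \<and> distr leb1 leb1 T = leb1"

definition eln :: "real \<Rightarrow> ereal" where
  "eln x = (if x = 0 then -\<infinity> else ereal (ln x))"

definition pw_expanding :: "bool \<Rightarrow> (real \<Rightarrow> real) \<Rightarrow> bool" where
  "pw_expanding const T \<longleftrightarrow>
     (\<forall>x\<in>{0..<1}. T x \<in> {0..<1}) \<and>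
     (\<exists>N (a::nat \<Rightarrow> real). N \<ge> 1 \<and> a 0 = 0 \<and> a N = 1 \<and> (\<forall>i<N. a i < a (Suc i)) \<and>
        (\<forall>i<N. \<exists>g g' g''.
            (\<forall>x\<in>{a i..a (Suc i)}.
               (g has_real_derivative g' x) (at x within {a i..a (Suc i)}) \<and>
               (g' has_real_derivative g'' x) (at x within {a i..a (Suc i)}) \<and>
               \<bar>g' x\<bar> > 1) \<and>
            continuous_on {a i..a (Suc i)} g'' \<and>
            (\<forall>x\<in>{a i<..<a (Suc i)}. T x = frac (g x)) \<and>
            (const \<longrightarrow> (\<forall>x\<in>{a i<..<a (Suc i)}. g' x = g' (a i)))))"

definition expanding_map :: "(real \<Rightarrow> real) \<Rightarrow> bool" where
  "expanding_map T = pw_expanding False T"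

definition pw_affine_expanding :: "(real \<Rightarrow> real) \<Rightarrow> bool" where
  "pw_affine_expanding T = pw_expanding True T"

text \<open>Derivative DT(x) of a circle map: derivative of a local lift of T, taken from the
  right (so that it is defined at every point, also at the partition points).\<close>
definition cderiv :: "(real \<Rightarrow> real) \<Rightarrow> real \<Rightarrow> real" where
  "cderiv T x = (THE c. \<exists>g. (g has_real_derivative c) (at x within {x..}) \<and>
                            (\<forall>\<^sub>F y in at_right x. T y = frac (g y)))"

definition PF :: "(real \<Rightarrow> real) \<Rightarrow> (real \<Rightarrow> real) \<Rightarrow> real \<Rightarrow> real" where
  "PF T f x = (\<Sum>y\<in>{y\<in>{0..<1}. T y = x}. f y / \<bar>cderiv T y\<bar>)"

definition dpow :: "(real \<Rightarrow> real) \<Rightarrow> nat \<Rightarrow> real \<Rightarrow> real" where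
  "dpow T n x = (\<Prod>k<n. cderiv T ((T ^^ k) x))"

definition theta_map :: "(real \<Rightarrow> real) \<Rightarrow> real" where
  "theta_map T = lim (\<lambda>n. SUP x\<in>{0..<1}. \<bar>dpow T n x\<bar> powr (- 1 / real n))"

definition circle_var :: "(real \<Rightarrow> real) \<Rightarrow> ereal" where
  "circle_var g = (SUP xs\<in>{xs. sorted_wrt (<) xs \<and> set xs \<subseteq> {0..<1}}.
      ereal (\<Sum>j<length xs. \<bar>g (xs ! ((j + 1) mod length xs)) - g (xs ! j)\<bar>))"

definition bv_var :: "(real \<Rightarrow> real) \<Rightarrow> ereal" where
  "bv_var f = (INF g\<in>{g. AE x in leb1. g x = f x}. circle_var g)"

definition BV :: "(real \<Rightarrow> real) set" where
  "BV = {f. f \<in> borel_measurable leb1 \<and> (\<exists>C. AE x in leb1. \<bar>f x\<bar> \<le> C) \<and> bv_var f < \<infinity>}"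

definition bv_norm :: "(real \<Rightarrow> real) \<Rightarrow> real" where
  "bv_norm f = max (\<integral>x. \<bar>f x\<bar> \<partial>leb1) (real_of_ereal (bv_var f))"

definition circle_interval :: "real set \<Rightarrow> bool" where
  "circle_interval I \<longleftrightarrow> (\<exists>J. is_interval J \<and> (\<exists>a b. a < b \<and> {a<..<b} \<subseteq> J) \<and> I = frac ` J)"

definition circle_partition :: "nat \<Rightarrow> (nat \<Rightarrow> real set) \<Rightarrow> bool" where
  "circle_partition M B \<longleftrightarrow> M \<ge> 1 \<and> (\<forall>k<M. circle_interval (B k)) \<and>
     (\<forall>j<M. \<forall>k<M. j \<noteq> k \<longrightarrow> B j \<inter> B k = {}) \<and> (\<Union>k<M. B k) = {0..<1}"

definition markov_partition :: "(real \<Rightarrow> real) \<Rightarrow> nat \<Rightarrow> (nat \<Rightarrow> real set) \<Rightarrow> bool" where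
  "markov_partition T M B \<longleftrightarrow> circle_partition M B \<and>
     (\<forall>i<M. \<forall>j<M. B i \<inter> T ` B j \<noteq> {} \<longrightarrow> B i \<subseteq> T ` B j)"

definition chiB :: "nat \<Rightarrow> (nat \<Rightarrow> real set) \<Rightarrow> (real \<Rightarrow> real) set" where
  "chiB M B = {f. f \<in> borel_measurable leb1 \<and> (\<forall>k<M. \<exists>c. AE x in leb1. x \<in> B k \<longrightarrow> f x = c)}"

text \<open>Exceptional eigenvalue of the restriction of P_T to a space V of functions
  (eigenvalues taken over the complexification: P(f + i g) = lam (f + i g)).\<close>
definition exceptional_eigenvalue :: "(real \<Rightarrow> real) \<Rightarrow> (real \<Rightarrow> real) set \<Rightarrow> complex \<Rightarrow> bool" where
  "exceptional_eigenvalue T V lam \<longleftrightarrow> lam \<noteq> 1 \<and> cmod lam > theta_map T \<and>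
     (\<exists>f g. f \<in> V \<and> g \<in> V \<and> \<not> (AE x in leb1. f x = 0 \<and> g x = 0) \<and>
        (AE x in leb1. PF T f x = Re lam * f x - Im lam * g x) \<and>
        (AE x in leb1. PF T g x = Im lam * f x + Re lam * g x))"

definition Emat :: "nat \<Rightarrow> nat \<Rightarrow> nat" where
  "Emat i j = [[0,1,0,0,1,0],
               [0,0,1,0,0,1],
               [1,0,0,1,0,0],
               [0,0,1,0,0,1],
               [1,0,0,1,0,0],
               [0,1,0,0,1,0]] ! (i - 1) ! (j - 1)"

definition Theta :: "(int \<Rightarrow> nat) set" where
  "Theta = {\<omega>. (\<forall>k. \<omega> k \<in> {1..6}) \<and> (\<forall>k. Emat (\<omega> k) (\<omega> (k + 1)) = 1)}"

definition shift :: "(int \<Rightarrow> nat) \<Rightarrow> (int \<Rightarrow> nat)" where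
  "shift \<omega> = (\<lambda>k. \<omega> (k + 1))"

fun mcoc :: "(nat \<Rightarrow> real \<Rightarrow> real) \<Rightarrow> (int \<Rightarrow> nat) \<Rightarrow> nat \<Rightarrow> real \<Rightarrow> real" where
  "mcoc S \<omega> 0 = id"
| "mcoc S \<omega> (Suc n) = S (\<omega> (int n)) \<circ> mcoc S \<omega> n"

definition dcoc :: "(nat \<Rightarrow> real \<Rightarrow> real) \<Rightarrow> (int \<Rightarrow> nat) \<Rightarrow> nat \<Rightarrow> real \<Rightarrow> real" where
  "dcoc S \<omega> n x = (\<Prod>k<n. cderiv (S (\<omega> (int k))) (mcoc S \<omega> k x))"

fun pcoc :: "(nat \<Rightarrow> real \<Rightarrow> real) \<Rightarrow> (int \<Rightarrow> nat) \<Rightarrow> nat \<Rightarrow> (real \<Rightarrow> real) \<Rightarrow> real \<Rightarrow> real" where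
  "pcoc S \<omega> 0 f = f"
| "pcoc S \<omega> (Suc n) f = PF (S (\<omega> (int n))) (pcoc S \<omega> n f)"

definition ess_bound :: "(nat \<Rightarrow> real \<Rightarrow> real) \<Rightarrow> (int \<Rightarrow> nat) \<Rightarrow> ereal" where
  "ess_bound S \<omega> = - (INF x\<in>{0..<1}. limsup (\<lambda>n. ereal (1 / real n) * eln \<bar>dcoc S \<omega> n x\<bar>))"

definition lyap :: "(nat \<Rightarrow> real \<Rightarrow> real) \<Rightarrow> (int \<Rightarrow> nat) \<Rightarrow> (real \<Rightarrow> real) \<Rightarrow> ereal" where
  "lyap S \<omega> f = limsup (\<lambda>n. ereal (1 / real n) * eln (bv_norm (pcoc S \<omega> n f)))"

definition lyap_spectrum :: "(nat \<Rightarrow> real \<Rightarrow> real) \<Rightarrow> (int \<Rightarrow> nat) \<Rightarrow> ereal set" where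
  "lyap_spectrum S \<omega> = {lyap S \<omega> f | f. f \<in> BV}"

definition exceptional_exponents :: "(nat \<Rightarrow> real \<Rightarrow> real) \<Rightarrow> (int \<Rightarrow> nat) \<Rightarrow> ereal set" where
  "exceptional_exponents S \<omega> = {l \<in> lyap_spectrum S \<omega>. ess_bound S \<omega> < l \<and> l < 0}"

text \<open>R^M is represented by functions nat => real vanishing from index M on.\<close>
definition vecs :: "nat \<Rightarrow> (nat \<Rightarrow> real) set" where
  "vecs M = {v. \<forall>k\<ge>M. v k = 0}"

definition vnorm :: "nat \<Rightarrow> (nat \<Rightarrow> real) \<Rightarrow> real" where
  "vnorm M v = sqrt (\<Sum>k<M. (v k)\<^sup>2)"

definition vlift :: "nat \<Rightarrow> (nat \<Rightarrow> real set) \<Rightarrow> (nat \<Rightarrow> real) \<Rightarrow> real \<Rightarrow> real" where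
  "vlift M B v = (\<lambda>x. \<Sum>k<M. v k * indicator (B k) x)"

definition Amat :: "(nat \<Rightarrow> real \<Rightarrow> real) \<Rightarrow> nat \<Rightarrow> (nat \<Rightarrow> real set) \<Rightarrow> nat \<Rightarrow> (nat \<Rightarrow> real) \<Rightarrow> nat \<Rightarrow> real" where
  "Amat S M B i v = (THE w. w \<in> vecs M \<and> (AE x in leb1. PF (S i) (vlift M B v) x = vlift M B w x))"

fun Acoc :: "(nat \<Rightarrow> real \<Rightarrow> real) \<Rightarrow> nat \<Rightarrow> (nat \<Rightarrow> real set) \<Rightarrow> (int \<Rightarrow> nat) \<Rightarrow> nat \<Rightarrow> (nat \<Rightarrow> real) \<Rightarrow> nat \<Rightarrow> real" where
  "Acoc S M B \<omega> 0 v = v"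
| "Acoc S M B \<omega> (Suc n) v = Amat S M B (\<omega> (int n)) (Acoc S M B \<omega> n v)"

definition lin_subspace :: "nat \<Rightarrow> (nat \<Rightarrow> real) set \<Rightarrow> bool" where
  "lin_subspace M W \<longleftrightarrow> W \<subseteq> vecs M \<and> (\<lambda>k. 0) \<in> W \<and>
     (\<forall>v\<in>W. \<forall>w\<in>W. (\<lambda>k. v k + w k) \<in> W) \<and> (\<forall>c. \<forall>v\<in>W. (\<lambda>k. c * v k) \<in> W)"

definition direct_sum :: "nat \<Rightarrow> nat \<Rightarrow> (nat \<Rightarrow> (nat \<Rightarrow> real) set) \<Rightarrow> bool" where
  "direct_sum M ell W \<longleftrightarrow>
     (\<forall>j\<in>{1..ell}. lin_subspace M (W j) \<and> W j \<noteq> {\<lambda>k. 0}) \<and>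
     (\<forall>v\<in>vecs M. \<exists>w. (\<forall>j\<in>{1..ell}. w j \<in> W j) \<and> v = (\<lambda>k. \<Sum>j\<in>{1..ell}. w j k)) \<and>
     (\<forall>w. (\<forall>j\<in>{1..ell}. w j \<in> W j) \<and> (\<lambda>k. \<Sum>j\<in>{1..ell}. w j k) = (\<lambda>k. 0) \<longrightarrow>
          (\<forall>j\<in>{1..ell}. w j = (\<lambda>k. 0)))"

definition oseledets_decomposition ::
  "(nat \<Rightarrow> real \<Rightarrow> real) \<Rightarrow> nat \<Rightarrow> (nat \<Rightarrow> real set) \<Rightarrow> ((int \<Rightarrow> nat) \<Rightarrow> nat) \<Rightarrow>
   ((int \<Rightarrow> nat) \<Rightarrow> nat \<Rightarrow> ereal) \<Rightarrow> ((int \<Rightarrow> nat) \<Rightarrow> nat \<Rightarrow> (nat \<Rightarrow> real) set) \<Rightarrow> bool" where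
  "oseledets_decomposition S M B ell lam W \<longleftrightarrow>
     (\<forall>\<omega>\<in>Theta.
        ell \<omega> \<ge> 1 \<and>
        direct_sum M (ell \<omega>) (W \<omega>) \<and>
        (\<forall>j\<in>{1..<ell \<omega>}. lam \<omega> j > lam \<omega> (Suc j)) \<and>
        (\<forall>j\<in>{1..ell \<omega>}. Amat S M B (\<omega> 0) ` W \<omega> j \<subseteq> W (shift \<omega>) j \<and>
           (lam \<omega> j > -\<infinity> \<longrightarrow> Amat S M B (\<omega> 0) ` W \<omega> j = W (shift \<omega>) j)) \<and>
        (\<forall>j\<in>{1..ell \<omega>}. \<forall>v\<in>W \<omega> j. v \<noteq> (\<lambda>k. 0) \<longrightarrow>
           ((\<lambda>n. ereal (1 / real n) * eln (vnorm M (Acoc S M B \<omega> n v))) \<longlonglongrightarrow> lam \<omega> j)))"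

end

theory Submission
  imports Defs "HOL-Real_Asymp.Real_Asymp"
begin

text \<open>
  All six maps send each twelfth of the circle affinely, with slope 3, onto a quarter, so on
  functions constant on quarters they act by one third of integer matrices with row and column
  sums 3. Let \<open>T\<close> be 3 minus the Laplacian of the path on four vertices, with eigenvalues
  \<open>3, 1 + sqrt 2, 1, 1 - sqrt 2\<close>, and let \<open>R\<close> be the cyclic permutation of three of the four
  quarters given by 0, 1, 3. The symbols fall into three classes modulo 3, and the map with
  symbol \<open>i\<close> acts as \<open>G' T G\<^sup>-\<^sup>1\<close>, where \<open>G\<close> is the power of \<open>R\<close> attached to the class of \<open>i\<close> and
  \<open>G'\<close> the one attached to the common class of the symbols that may follow \<open>i\<close>. Along an admissible
  sequence the permutations cancel, and the cocycle is conjugate to the powers of \<open>T\<close>. A single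
  map is conjugate to \<open>T R\<close> or \<open>T R\<^sup>-\<^sup>1\<close>, whose fourth power is the identity on zero-sum vectors.

  For a general function of bounded variation, the variation inside the quarters contracts by
  1/3 per step. The values at the left endpoints of the quarters therefore follow the matrix
  cocycle up to an error of order \<open>3\<^sup>-\<^sup>n\<close>, and the eigencoordinate with multiplier
  \<open>(1 + sqrt 2) / 3\<close> converges after rescaling. If the
  coordinate with multiplier 1 has limit zero, whether this limit vanishes decides the exponent.
\<close>

section \<open>Full-branch maps of slope three\<close>

text \<open>Two local lifts of the same circle map differ by an integer-valued function to the right
  of \<open>x\<close>; continuity makes this difference constant there, so the derivatives agree.
  This settles uniqueness in the \<open>THE\<close> of \<open>cderiv\<close>.\<close>

lemma cderiv_eqI:
  assumes T: "\<forall>\<^sub>F y in at_right x. T y = frac (h y)"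
    and h: "(h has_real_derivative d) (at x within {x..})"
  shows "cderiv T x = d"
  unfolding cderiv_def
proof (rule the_equality)
  show "\<exists>g. (g has_real_derivative d) (at x within {x..}) \<and> (\<forall>\<^sub>F y in at_right x. T y = frac (g y))"
    using assms by blast
next
  fix c assume "\<exists>g. (g has_real_derivative c) (at x within {x..}) \<and> (\<forall>\<^sub>F y in at_right x. T y = frac (g y))"
  then obtain g where g: "(g has_real_derivative c) (at x within {x..})"
    and Tg: "\<forall>\<^sub>F y in at_right x. T y = frac (g y)" by blast
  define D where "D y = g y - h y" for y
  have D: "(D has_real_derivative (c - d)) (at x within {x..})"
    unfolding D_def by (intro derivative_intros g h)
  have "continuous (at x within {x..}) D"
    using D by (rule DERIV_continuous)
  hence lim: "(D \<longlongrightarrow> D x) (at_right x)"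
    by (simp add: continuous_within at_within_Ici_at_right)
  have int: "\<forall>\<^sub>F y in at_right x. D y \<in> \<int>"
    using T Tg by eventually_elim (auto simp: D_def frac_def Ints_def algebra_simps intro!: image_eqI[where x="floor (g _) - floor (h _)"])
  have near: "\<forall>\<^sub>F y in at_right x. dist (D y) (D x) < 1/2"
    using lim by (rule tendstoD) simp
  have ev: "\<forall>\<^sub>F y in at_right x. D y \<in> \<int> \<and> dist (D y) (D x) < 1/2"
    using int near by eventually_elim blast
  \<comment> \<open>\<open>D x\<close> is not yet known to be an integer, since
    \<open>at_right x\<close> omits \<open>x\<close>. A sample point \<open>y0\<close> supplies the
    integer, and two integers within 1/2 of \<open>D x\<close> coincide.\<close>
  obtain y0 where y0: "D y0 \<in> \<int>" "dist (D y0) (D x) < 1/2"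
    using eventually_happens'[OF _ ev] by auto
  have const: "\<forall>\<^sub>F y in at_right x. D y = D y0"
    using ev
  proof eventually_elim
    case (elim y)
    obtain m n where mn: "D y = of_int m" "D y0 = of_int n"
      using elim y0 by (auto elim!: Ints_cases)
    have "\<bar>D y - D y0\<bar> < 1" using elim y0 unfolding dist_real_def by linarith
    hence "m = n" unfolding mn by linarith
    thus ?case using mn by simp
  qed
  have "(D \<longlongrightarrow> D y0) (at_right x)"
    using const by (rule tendsto_eventually)
  hence Dx: "D x = D y0" using lim by (metis tendsto_unique trivial_limit_at_right_real)
  have "((\<lambda>y. (D y - D x) / (y - x)) \<longlongrightarrow> c - d) (at_right x)"
    using D by (simp add: has_field_derivative_iff at_within_Ici_at_right)
  moreover have "\<forall>\<^sub>F y in at_right x. (D y - D x) / (y - x) = 0"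
    using const by eventually_elim (simp add: Dx)
  hence "((\<lambda>y. (D y - D x) / (y - x)) \<longlongrightarrow> 0) (at_right x)"
    by (rule tendsto_eventually)
  ultimately have "c - d = 0"
    by (metis tendsto_unique trivial_limit_at_right_real)
  thus "c = d" by simp
qed

text \<open>\<open>t j\<close> is the quarter onto which twelfth \<open>j\<close> is stretched; the
  floor picks the twelfth and the fractional part is the position inside it.\<close>

definition smap :: "(nat \<Rightarrow> nat) \<Rightarrow> real \<Rightarrow> real" where
  "smap t x = (real (t (nat \<lfloor>12 * x\<rfloor>)) + frac (12 * x)) / 4"

definition quarter :: "nat \<Rightarrow> real set" where
  "quarter k = {real k / 4..<(real k + 1) / 4}"

text \<open>Three branches of slope 3 over every quarter have total weight 1, which is what
  invariance of Lebesgue measure requires.\<close>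

definition balanced :: "(nat \<Rightarrow> nat) \<Rightarrow> bool" where
  "balanced t \<longleftrightarrow> (\<forall>j<12. t j < 4) \<and> (\<forall>k<4. card {j. j < 12 \<and> t j = k} = 3)"

lemma smap_branch: "0 \<le> u \<Longrightarrow> u < 1 \<Longrightarrow> smap t ((real j + u) / 12) = (real (t j) + u) / 4"
proof -
  assume u: "0 \<le> u" "u < 1"
  have "\<lfloor>real j + u\<rfloor> = int j" using u by linarith
  moreover have "frac (real j + u) = u"
    using u by (simp add: frac_def calculation)
  moreover have "12 * ((real j + u) / 12) = real j + u" by simp
  ultimately show ?thesis by (simp only: smap_def nat_int)
qed

lemma twelfth_ex:
  assumes "0 \<le> x" "x < 1"
  obtains j u where "j < 12" "0 \<le> u" "u < 1" "x = (real j + u) / 12"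
proof (rule that[of "nat \<lfloor>12 * x\<rfloor>" "frac (12 * x)"])
  show "nat \<lfloor>12 * x\<rfloor> < 12" using assms by linarith
  show "x = (real (nat \<lfloor>12 * x\<rfloor>) + frac (12 * x)) / 12"
    using assms by (simp add: frac_def)
qed (auto simp: frac_lt_1)

lemma quarter_ex:
  assumes "0 \<le> x" "x < 1"
  obtains k u where "k < 4" "0 \<le> u" "u < 1" "x = (real k + u) / 4"
proof (rule that[of "nat \<lfloor>4 * x\<rfloor>" "frac (4 * x)"])
  show "nat \<lfloor>4 * x\<rfloor> < 4" using assms by linarith
  show "x = (real (nat \<lfloor>4 * x\<rfloor>) + frac (4 * x)) / 4"
    using assms by (simp add: frac_def)
qed (auto simp: frac_lt_1)

lemma nat_plus_frac_inject:
  assumes "real k + u = real l + v" "0 \<le> u" "u < 1" "0 \<le> v" "v < 1"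
  shows "k = l \<and> u = v"
proof -
  have "\<bar>real k - real l\<bar> < 1" using assms by linarith
  hence "k = l" by linarith
  thus ?thesis using assms(1) by auto
qed

lemma smap_range: "balanced t \<Longrightarrow> x \<in> {0..<1} \<Longrightarrow> smap t x \<in> {0..<1}"
proof -
  assume t: "balanced t" and "x \<in> {0..<1}"
  then obtain j u where ju: "j < 12" "0 \<le> u" "u < 1" "x = (real j + u) / 12"
    using twelfth_ex by auto
  have "t j < 4" using t ju by (auto simp: balanced_def)
  hence "real (t j) \<le> 3" by simp
  thus ?thesis unfolding ju(4) smap_branch[OF ju(2,3)] using ju by simp
qed

lemma frac_smap: "balanced t \<Longrightarrow> x \<in> {0..<1} \<Longrightarrow> frac (smap t x) = smap t x"
  using smap_range by (simp add: frac_eq)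

text \<open>Twelfths are closed on the left, so some interval to the right of any \<open>x\<close>,
  breakpoints included, stays in the twelfth of \<open>x\<close>, where the branch formula is a lift
  of slope 3.\<close>

lemma cderiv_smap:
  assumes t: "balanced t" and x: "x \<in> {0..<1}"
  shows "cderiv (smap t) x = 3"
proof -
  obtain j u where ju: "j < 12" "0 \<le> u" "u < 1" "x = (real j + u) / 12"
    using x twelfth_ex by auto
  define h where "h y = real (t j) / 4 + (12 * y - real j) / 4" for y
  have "\<forall>\<^sub>F y in at_right x. y \<in> {x<..<(real j + 1) / 12}"
    using ju by (intro eventually_at_right_real) (simp add: field_simps)
  hence "\<forall>\<^sub>F y in at_right x. smap t y = frac (h y)"
  proof eventually_elim
    case (elim y)
    define v where "v = 12 * y - real j"
    have y: "y = (real j + v) / 12" by (simp add: v_def)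
    have v: "0 \<le> v" "v < 1" using elim ju by (auto simp: v_def field_simps)
    have "real j \<le> 11" using ju by simp
    hence "y \<in> {0..<1}" using elim x by auto
    hence "frac (smap t y) = smap t y" using frac_smap[OF t] by simp
    moreover have "smap t y = h y" unfolding y by (simp only: smap_branch[OF v]) (simp add: h_def add_divide_distrib)
    ultimately show ?case by simp
  qed
  moreover have "(h has_real_derivative 3) (at x within {x..})"
    unfolding h_def by (auto intro!: derivative_eq_intros)
  ultimately show ?thesis by (rule cderiv_eqI)
qed

text \<open>A point of quarter \<open>k\<close> has exactly one preimage in each twelfth assigned to
  \<open>k\<close>, at the same relative position \<open>u\<close>, and each has weight 1/3.\<close>

lemma PF_smap:
  assumes t: "balanced t" and "k < 4" "0 \<le> u" "u < 1"
  shows "PF (smap t) f ((real k + u) / 4) = (\<Sum>j | j < 12 \<and> t j = k. f ((real j + u) / 12)) / 3"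
proof -
  have set: "{y \<in> {0..<1}. smap t y = (real k + u) / 4} = (\<lambda>j. (real j + u) / 12) ` {j. j < 12 \<and> t j = k}"
  proof (intro equalityI subsetI)
    fix y assume y: "y \<in> {y \<in> {0..<1}. smap t y = (real k + u) / 4}"
    then obtain j v where jv: "j < 12" "0 \<le> v" "v < 1" "y = (real j + v) / 12"
      using twelfth_ex by auto
    have "smap t y = (real k + u) / 4" using y by simp
    hence "real (t j) + v = real k + u" unfolding jv(4) smap_branch[OF jv(2,3)] by simp
    hence "t j = k" "v = u" using nat_plus_frac_inject assms jv by blast+
    thus "y \<in> (\<lambda>j. (real j + u) / 12) ` {j. j < 12 \<and> t j = k}" using jv by blast
  next
    fix y assume "y \<in> (\<lambda>j. (real j + u) / 12) ` {j. j < 12 \<and> t j = k}"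
    then obtain j where j: "j < 12" "t j = k" "y = (real j + u) / 12" by auto
    have "real j \<le> 11" using j by simp
    hence "y \<in> {0..<1}" using j assms by auto
    moreover have "smap t y = (real k + u) / 4"
      unfolding j(3) smap_branch[OF assms(3,4)] j(2) ..
    ultimately show "y \<in> {y \<in> {0..<1}. smap t y = (real k + u) / 4}"
      by blast
  qed
  have inj: "inj_on (\<lambda>j. (real j + u) / 12) {j. j < 12 \<and> t j = k}"
    by (auto simp: inj_on_def)
  have "PF (smap t) f ((real k + u) / 4) = (\<Sum>j | j < 12 \<and> t j = k. f ((real j + u) / 12) / \<bar>cderiv (smap t) ((real j + u) / 12)\<bar>)"
    unfolding PF_def set by (subst sum.reindex[OF inj]) simp
  also have "\<dots> = (\<Sum>j | j < 12 \<and> t j = k. f ((real j + u) / 12) / 3)"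
  proof (rule sum.cong[OF refl])
    fix j assume "j \<in> {j. j < 12 \<and> t j = k}"
    hence "real j \<le> 11" by auto
    hence "(real j + u) / 12 \<in> {0..<1}" using assms by auto
    thus "f ((real j + u) / 12) / \<bar>cderiv (smap t) ((real j + u) / 12)\<bar> = f ((real j + u) / 12) / 3"
      by (simp add: cderiv_smap[OF t])
  qed
  finally show ?thesis by (simp add: sum_divide_distrib)
qed

lemma smap_pw_affine_expanding:
  assumes t: "balanced t"
  shows "pw_affine_expanding (smap t)"
  unfolding pw_affine_expanding_def pw_expanding_def
proof (intro conjI exI[of _ "12::nat"] exI[of _ "\<lambda>i. real i / 12"] ballI allI impI)
  fix i :: nat assume i: "i < 12"
  show "\<exists>g g' g''.
            (\<forall>x\<in>{real i / 12..real (Suc i) / 12}.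
               (g has_real_derivative g' x) (at x within {real i / 12..real (Suc i) / 12}) \<and>
               (g' has_real_derivative g'' x) (at x within {real i / 12..real (Suc i) / 12}) \<and>
               \<bar>g' x\<bar> > 1) \<and>
            continuous_on {real i / 12..real (Suc i) / 12} g'' \<and>
            (\<forall>x\<in>{real i / 12<..<real (Suc i) / 12}. smap t x = frac (g x)) \<and>
            (True \<longrightarrow> (\<forall>x\<in>{real i / 12<..<real (Suc i) / 12}. g' x = g' (real i / 12)))"
  proof (rule exI[of _ "\<lambda>x. real (t i) / 4 + (12 * x - real i) / 4"], rule exI[of _ "\<lambda>x. 3"], rule exI[of _ "\<lambda>x. 0"], intro conjI ballI impI)
    fix x assume x: "x \<in> {real i / 12<..<real (Suc i) / 12}"
    define v where "v = 12 * x - real i"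
    have xv: "x = (real i + v) / 12" by (simp add: v_def)
    have v: "0 \<le> v" "v < 1" using x by (auto simp: v_def field_simps)
    have "real i \<le> 11" using i by simp
    hence "x \<in> {0..<1}" using v by (auto simp: xv)
    hence "frac (smap t x) = smap t x" using frac_smap[OF t] by simp
    moreover have "smap t x = real (t i) / 4 + (12 * x - real i) / 4"
      unfolding xv by (simp only: smap_branch[OF v]) (simp add: add_divide_distrib)
    ultimately show "smap t x = frac (real (t i) / 4 + (12 * x - real i) / 4)" by simp
  qed (auto intro!: derivative_eq_intros)
qed (use smap_range[OF t] in auto)

lemma in_quarter_iff: "x \<in> quarter k \<longleftrightarrow> (\<exists>u. 0 \<le> u \<and> u < 1 \<and> x = (real k + u) / 4)"
proof
  assume "x \<in> quarter k"
  thus "\<exists>u. 0 \<le> u \<and> u < 1 \<and> x = (real k + u) / 4"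
    by (intro exI[of _ "4 * x - real k"]) (auto simp: quarter_def field_simps)
qed (auto simp: quarter_def field_simps)

lemma quarter_unique: "0 \<le> u \<Longrightarrow> u < 1 \<Longrightarrow> (real k + u) / 4 \<in> quarter l \<longleftrightarrow> l = k"
  using nat_plus_frac_inject by (fastforce simp: in_quarter_iff)

lemma quarter_subset: "k < 4 \<Longrightarrow> quarter k \<subseteq> {0..<1}"
proof
  fix x assume "k < 4" "x \<in> quarter k"
  moreover from this have "real k \<le> 3" by simp
  ultimately show "x \<in> {0..<1}" by (auto simp: in_quarter_iff)
qed

lemma circle_partition_quarter: "circle_partition 4 quarter"
  unfolding circle_partition_def
proof (intro conjI allI impI)
  fix k :: nat assume k: "k < 4"
  have "frac ` quarter k = id ` quarter k"
    by (intro image_cong refl) (use quarter_subset[OF k] in \<open>auto simp: frac_eq\<close>)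
  thus "circle_interval (quarter k)"
    unfolding circle_interval_def
    by (intro exI[of _ "quarter k"] conjI exI[of _ "real k / 4"] exI[of _ "(real k + 1) / 4"])
       (auto simp: quarter_def is_interval_co)
next
  fix j k :: nat assume "j \<noteq> k"
  thus "quarter j \<inter> quarter k = {}"
    using quarter_unique[of _ j k] unfolding disjoint_iff in_quarter_iff[of _ j] by metis
next
  show "(\<Union>k<4. quarter k) = {0..<1}"
  proof
    show "(\<Union>k<4. quarter k) \<subseteq> {0..<1}" using quarter_subset by blast
    show "{0..<1} \<subseteq> (\<Union>k<4. quarter k)"
    proof
      fix x :: real assume "x \<in> {0..<1}"
      then obtain k u where "k < 4" "0 \<le> u" "u < 1" "x = (real k + u) / 4"
        using quarter_ex by auto
      thus "x \<in> (\<Union>k<4. quarter k)" by (auto simp: in_quarter_iff)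
    qed
  qed
qed simp

text \<open>Twelfth \<open>j\<close> is the third with number \<open>j mod 3\<close> of quarter
  \<open>j div 3\<close>. This change of coordinates underlies both the Markov property and the
  contraction of variation.\<close>

lemma twelfth_in_quarter: "(real j + u) / 12 = (real (j div 3) + (real (j mod 3) + u) / 3) / 4"
proof -
  have "real j = 3 * real (j div 3) + real (j mod 3)"
    by (metis div_mult_mod_eq mult.commute of_nat_add of_nat_mult of_nat_numeral)
  thus ?thesis by simp
qed

lemma twelfth_sub: "0 \<le> u \<Longrightarrow> u < 1 \<Longrightarrow> 0 \<le> (real (j mod 3) + u) / 3 \<and> (real (j mod 3) + u) / 3 < 1"
proof -
  assume u: "0 \<le> u" "u < 1"
  have "real (j mod 3) \<le> 2" by (simp add: less_Suc_eq_le[symmetric])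
  thus ?thesis using u by simp
qed

text \<open>Each quarter is a union of three twelfths, and each of these is mapped onto a full
  quarter, so hitting a quarter at one point means covering it.\<close>

lemma markov_partition_smap:
  assumes t: "balanced t"
  shows "markov_partition (smap t) 4 quarter"
  unfolding markov_partition_def
proof (intro conjI circle_partition_quarter allI impI)
  fix i j :: nat assume ij: "i < 4" "j < 4" "quarter i \<inter> smap t ` quarter j \<noteq> {}"
  then obtain x where x: "x \<in> quarter j" "smap t x \<in> quarter i" by auto
  have "x \<in> {0..<1}" using quarter_subset[OF ij(2)] x(1) by blast
  then obtain l u where lu: "l < 12" "0 \<le> u" "u < 1" "x = (real l + u) / 12"
    using twelfth_ex by auto
  have l: "l div 3 = j"
    using x(1) unfolding lu(4) twelfth_in_quarter[of l u]
    using quarter_unique twelfth_sub[of u l] lu by auto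
  have tl: "t l = i"
    using x(2) lu quarter_unique[of u "t l" i] by (simp add: smap_branch)
  show "quarter i \<subseteq> smap t ` quarter j"
  proof
    fix y assume "y \<in> quarter i"
    then obtain v where v: "0 \<le> v" "v < 1" "y = (real i + v) / 4" by (auto simp: in_quarter_iff)
    have "(real l + v) / 12 \<in> quarter j"
      unfolding twelfth_in_quarter[of l v] using twelfth_sub[of v l] v l quarter_unique by auto
    moreover have "smap t ((real l + v) / 12) = y" using v tl by (simp add: smap_branch)
    ultimately show "y \<in> smap t ` quarter j" by blast
  qed
qed

section \<open>Lebesgue measure under the maps\<close>

lemma space_leb1 [simp]: "space leb1 = {0..<1}"
  by (simp add: leb1_def space_restrict_space)

lemma AE_leb1_iff: "(AE x in leb1. P x) \<longleftrightarrow> (AE x in lborel. x \<in> {0..<1} \<longrightarrow> P x)"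
  unfolding leb1_def by (rule AE_restrict_space_iff) auto

lemma finite_measure_leb1: "finite_measure leb1"
  by (rule finite_measureI) (simp add: leb1_def emeasure_restrict_space space_restrict_space)

lemma measure_leb1_space: "measure leb1 {0..<1} = 1"
  by (simp add: leb1_def measure_restrict_space)

lemma quarter_sets [measurable]: "quarter k \<in> sets borel"
  by (simp add: quarter_def)

lemma emeasure_leb1: "A \<in> sets borel \<Longrightarrow> emeasure leb1 (A \<inter> {0..<1}) = emeasure lborel (A \<inter> {0..<1})"
  by (simp add: leb1_def emeasure_restrict_space)

lemma not_AE_quarter: "k < 4 \<Longrightarrow> \<not> (AE x in leb1. x \<notin> quarter k)"
proof
  assume k: "k < 4" and "AE x in leb1. x \<notin> quarter k"
  hence "AE x in lborel. x \<notin> quarter k"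
    unfolding AE_leb1_iff using quarter_subset[OF k] by (auto elim!: eventually_mono)
  hence "emeasure lborel (quarter k) = 0"
    by (subst (asm) AE_iff_measurable[of "quarter k"]) auto
  thus False by (simp add: quarter_def)
qed

text \<open>Quarters have positive measure, so an almost-everywhere identity has a witness in each
  of them; for functions constant on quarters this recovers the coefficients.\<close>

lemma AE_leb1_quarter_ex:
  assumes "AE x in leb1. P x" "k < 4"
  obtains x where "x \<in> quarter k" "P x"
proof -
  have "\<not> (AE x in leb1. x \<notin> quarter k)" using not_AE_quarter assms by blast
  hence "\<exists>x. x \<in> quarter k \<and> P x"
    using assms(1) by (meson eventually_mono)
  thus ?thesis using that by blast
qed

lemma smap_measurable [measurable]: "smap t \<in> borel_measurable borel"
proof -
  have "(\<lambda>x::real. real (t (nat \<lfloor>12 * x\<rfloor>))) \<in> borel_measurable borel"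
    by measurable
  thus ?thesis unfolding smap_def[abs_def] frac_def by measurable
qed

text \<open>A partition of unity in \<open>ennreal\<close>, used to split an integral over the
  circle into its twelve branches.\<close>

lemma twelfth_cover:
  assumes "x \<in> {0..<1}"
  shows "(\<Sum>j<12. indicator {real j / 12..<(real j + 1) / 12} x :: ennreal) = 1"
proof -
  obtain i u where iu: "i < 12" "0 \<le> u" "u < 1" "x = (real i + u) / 12"
    using assms twelfth_ex by auto
  have "x \<in> {real j / 12..<(real j + 1) / 12} \<longleftrightarrow> j = i" for j
  proof
    assume "x \<in> {real j / 12..<(real j + 1) / 12}"
    hence "0 \<le> 12 * x - real j" "12 * x - real j < 1" by auto
    moreover have "real j + (12 * x - real j) = real i + u" using iu(4) by simp
    ultimately show "j = i" using nat_plus_frac_inject iu(2,3) by blast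
  qed (use iu in auto)
  hence "(\<Sum>j<12. indicator {real j / 12..<(real j + 1) / 12} x :: ennreal) = (\<Sum>j<12. if j = i then 1 else 0)"
    by (intro sum.cong) (auto simp: indicator_def)
  thus ?thesis using iu(1) by simp
qed

lemma quarter_cover:
  assumes "x \<in> {0..<1}"
  shows "(\<Sum>k<4. indicator (quarter k) x :: ennreal) = 1"
proof -
  obtain i u where iu: "i < 4" "0 \<le> u" "u < 1" "x = (real i + u) / 4"
    using assms quarter_ex by auto
  have "x \<in> quarter j \<longleftrightarrow> j = i" for j unfolding iu(4) by (rule quarter_unique[OF iu(2,3)])
  hence "(\<Sum>j<4. indicator (quarter j) x :: ennreal) = (\<Sum>j<4. if j = i then 1 else 0)"
    by (intro sum.cong) (auto simp: indicator_def)
  thus ?thesis using iu(1) by simp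
qed

lemma sum_fibres:
  fixes f :: "nat \<Rightarrow> 'a :: comm_semiring_1"
  assumes "balanced t"
  shows "(\<Sum>j<12. f (t j)) = 3 * (\<Sum>k<4. f k)"
proof -
  have "(\<Sum>j<12. f (t j)) = (\<Sum>k<4. \<Sum>j\<in>{j\<in>{..<12}. t j = k}. f (t j))"
    using assms by (intro sum.group[symmetric]) (auto simp: balanced_def)
  also have "\<dots> = (\<Sum>k<4. of_nat (card {j. j < 12 \<and> t j = k}) * f k)"
    by (intro sum.cong refl) (auto intro!: sum.cong simp flip: sum_constant)
  also have "\<dots> = (\<Sum>k<4. 3 * f k)"
    using assms by (intro sum.cong refl) (simp add: balanced_def)
  finally show ?thesis by (simp add: sum_distrib_left)
qed

lemma ennreal_third: "ennreal (1/3) * ennreal 3 = 1" "ennreal 3 * ennreal (1/3) = 1"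
proof -
  show "ennreal 3 * ennreal (1/3) = 1"
    by (subst ennreal_mult[symmetric]) (simp_all del: ennreal_numeral)
  thus "ennreal (1/3) * ennreal 3 = 1" by (simp only: mult.commute)
qed

text \<open>Substitution along one affine branch, whose slope 3 turns into the factor 1/3.\<close>

lemma branch_emeasure:
  assumes [measurable]: "A \<in> sets borel" and j: "j < 12"
  shows "(\<integral>\<^sup>+x. indicator A (smap t x) * indicator {real j / 12..<(real j + 1) / 12} x \<partial>lborel)
    = ennreal (1/3) * (\<integral>\<^sup>+x. indicator A x * indicator (quarter (t j)) x \<partial>lborel)"
proof -
  \<comment> \<open>With this offset \<open>c + 3 * x\<close> is the value of the map on twelfth
    \<open>j\<close>, and it lies in quarter \<open>t j\<close> exactly when \<open>x\<close> lies
    in that twelfth.\<close>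
  define c where "c = real (t j) / 4 - real j / 4"
  have eq: "indicator A (c + 3 * x) * indicator (quarter (t j)) (c + 3 * x)
      = (indicator A (smap t x) * indicator {real j / 12..<(real j + 1) / 12} x :: ennreal)" for x
  proof (cases "x \<in> {real j / 12..<(real j + 1) / 12}")
    case True
    define v where "v = 12 * x - real j"
    have x: "x = (real j + v) / 12" by (simp add: v_def)
    have v: "0 \<le> v" "v < 1" using True by (auto simp: v_def)
    have "smap t x = c + 3 * x"
      unfolding x smap_branch[OF v] c_def by (simp add: field_simps)
    moreover have "c + 3 * x \<in> quarter (t j)" using True by (auto simp: c_def quarter_def field_simps)
    ultimately show ?thesis using True by simp
  next
    case False
    hence "c + 3 * x \<notin> quarter (t j)" by (auto simp: c_def quarter_def field_simps)
    thus ?thesis using False by simp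
  qed
  have "(\<integral>\<^sup>+x. indicator A x * indicator (quarter (t j)) x \<partial>lborel) =
     ennreal \<bar>3\<bar> * (\<integral>\<^sup>+x. indicator A (c + 3 * x) * indicator (quarter (t j)) (c + 3 * x) \<partial>lborel)"
    by (rule nn_integral_real_affine) auto
  also have "\<dots> = ennreal 3 * (\<integral>\<^sup>+x. indicator A (smap t x) * indicator {real j / 12..<(real j + 1) / 12} x \<partial>lborel)"
    by (simp add: eq)
  finally show ?thesis by (simp only: mult.assoc[symmetric] mult_1_left ennreal_third)
qed

text \<open>The preimage of \<open>A\<close> is cut along the twelfths. Each branch contributes a
  third of the part of \<open>A\<close> in its target quarter, and \<open>sum_fibres\<close> counts
  every quarter three times.\<close>

lemma smap_preserves_leb:
  assumes t: "balanced t"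
  shows "preserves_leb (smap t)"
proof -
  have meas: "smap t \<in> measurable leb1 leb1"
    unfolding leb1_def
    by (rule measurable_restrict_space3) (use smap_range[OF t] in auto)
  have "distr leb1 leb1 (smap t) = leb1"
  proof (rule measure_eqI)
    fix A assume "A \<in> sets (distr leb1 leb1 (smap t))"
    hence A': "A \<in> sets leb1" by simp
    hence A [measurable]: "A \<in> sets borel" and Asub: "A \<subseteq> {0..<1}"
      by (auto simp: leb1_def sets_restrict_space_iff)
    have "emeasure (distr leb1 leb1 (smap t)) A = emeasure leb1 ((smap t -` A) \<inter> {0..<1})"
      using meas A' by (simp add: emeasure_distr)
    also have "\<dots> = emeasure lborel ((smap t -` A) \<inter> {0..<1})"
      using measurable_sets[OF smap_measurable A, of t] by (intro emeasure_leb1) simp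
    also have "\<dots> = (\<integral>\<^sup>+x. indicator ((smap t -` A) \<inter> {0..<1}) x \<partial>lborel)"
      using measurable_sets[OF smap_measurable A, of t] by (intro nn_integral_indicator[symmetric]) simp
    also have "\<dots> = (\<integral>\<^sup>+x. (\<Sum>j<12. indicator A (smap t x) * indicator {real j / 12..<(real j + 1) / 12} x) \<partial>lborel)"
    proof (rule nn_integral_cong)
      fix x :: real
      show "indicator ((smap t -` A) \<inter> {0..<1}) x = (\<Sum>j<12. indicator A (smap t x) * indicator {real j / 12..<(real j + 1) / 12} x :: ennreal)"
      proof (cases "x \<in> {0..<1}")
        case True
        thus ?thesis using twelfth_cover[OF True] by (simp add: indicator_def flip: sum_distrib_left)
      next
        case False
        have "x \<notin> {real j / 12..<(real j + 1) / 12}" if "j < 12" for j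
        proof -
          have "real j \<le> 11" using that by simp
          thus ?thesis using False by (auto simp: not_le)
        qed
        hence "(\<Sum>j<12. indicator A (smap t x) * indicator {real j / 12..<(real j + 1) / 12} x :: ennreal) = 0"
          by (intro sum.neutral) simp
        thus ?thesis using False by simp
      qed
    qed
    also have "\<dots> = (\<Sum>j<12. \<integral>\<^sup>+x. indicator A (smap t x) * indicator {real j / 12..<(real j + 1) / 12} x \<partial>lborel)"
      by (rule nn_integral_sum) auto
    also have "\<dots> = (\<Sum>j<12. ennreal (1/3) * (\<integral>\<^sup>+x. indicator A x * indicator (quarter (t j)) x \<partial>lborel))"
      by (intro sum.cong refl branch_emeasure) auto
    also have "\<dots> = 3 * (\<Sum>k<4. ennreal (1/3) * (\<integral>\<^sup>+x. indicator A x * indicator (quarter k) x \<partial>lborel))"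
      by (rule sum_fibres[OF t])
    also have "\<dots> = (ennreal 3 * ennreal (1/3)) * (\<Sum>k<4. \<integral>\<^sup>+x. indicator A x * indicator (quarter k) x \<partial>lborel)"
      by (simp add: sum_distrib_left mult.assoc)
    also have "ennreal 3 * ennreal (1/3) = 1"
      by (rule ennreal_third)
    also have "1 * (\<Sum>k<4. \<integral>\<^sup>+x. indicator A x * indicator (quarter k) x \<partial>lborel) = (\<integral>\<^sup>+x. (\<Sum>k<4. indicator A x * indicator (quarter k) x) \<partial>lborel)"
      by (subst nn_integral_sum) auto
    also have "\<dots> = (\<integral>\<^sup>+x. indicator A x \<partial>lborel)"
    proof (rule nn_integral_cong)
      fix x
      show "(\<Sum>k<4. indicator A x * indicator (quarter k) x) = (indicator A x :: ennreal)"
      proof (cases "x \<in> A")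
        case True
        hence "x \<in> {0..<1}" using Asub by blast
        thus ?thesis using quarter_cover by (simp flip: sum_distrib_left)
      qed simp
    qed
    also have "\<dots> = emeasure lborel (A \<inter> {0..<1})" using Asub by (simp add: Int_absorb2)
    also have "\<dots> = emeasure leb1 (A \<inter> {0..<1})" by (rule emeasure_leb1[symmetric]) simp
    finally show "emeasure (distr leb1 leb1 (smap t)) A = emeasure leb1 A"
      using Asub by (simp add: Int_absorb2)
  qed simp
  thus ?thesis using meas by (simp add: preserves_leb_def)
qed

section \<open>Perron-Frobenius operator: null sets and measurability\<close>

text \<open>One formula for all points of the circle: inverse branch \<open>j\<close> is the affine
  map \<open>x / 3 + (j - t j) / 12\<close>, switched on by the indicator of its target
  quarter.\<close>

lemma PF_smap_at:
  assumes t: "balanced t" and x: "x \<in> {0..<1}"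
  shows "PF (smap t) f x = (\<Sum>j<12. indicator (quarter (t j)) x * f (x / 3 + (real j - real (t j)) / 12)) / 3"
proof -
  obtain k u where ku: "k < 4" "0 \<le> u" "u < 1" "x = (real k + u) / 4"
    using x quarter_ex by auto
  have "(\<Sum>j<12. indicator (quarter (t j)) x * f (x / 3 + (real j - real (t j)) / 12))
      = (\<Sum>j<12. if t j = k then f ((real j + u) / 12) else 0)"
  proof (intro sum.cong refl)
    fix j
    have "x / 3 + (real j - real k) / 12 = (real j + u) / 12"
      by (simp add: ku field_simps)
    moreover have "x \<in> quarter (t j) \<longleftrightarrow> t j = k" using ku by (simp only: quarter_unique)
    ultimately show "indicator (quarter (t j)) x * f (x / 3 + (real j - real (t j)) / 12) = (if t j = k then f ((real j + u) / 12) else 0)"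
      by (cases "t j = k") (simp_all only: indicator_simps if_True if_False mult_1_left mult_zero_left simp_thms)
  qed
  also have "\<dots> = (\<Sum>j | j < 12 \<and> t j = k. f ((real j + u) / 12))"
    by (simp add: sum.If_cases Int_def)
  finally show ?thesis unfolding ku(4) PF_smap[OF t ku(1-3)] by simp
qed

text \<open>\<open>bv_var\<close> sees functions only up to null sets. The affine inverse branches
  pull a null set back to null sets, so equality almost everywhere survives the operator.\<close>

lemma PF_smap_cong_AE:
  assumes t: "balanced t" and "AE x in leb1. f x = g x"
  shows "AE x in leb1. PF (smap t) f x = PF (smap t) g x"
proof -
  have "AE x in lborel. x \<in> {0..<1} \<longrightarrow> f x = g x" using assms(2) by (simp add: AE_leb1_iff)
  then obtain N where N: "{x \<in> space lborel. \<not> (x \<in> {0..<1} \<longrightarrow> f x = g x)} \<subseteq> N"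
      "emeasure lborel N = 0" "N \<in> sets lborel" by (elim AE_E)
  have N0: "AE x in lborel. x \<notin> N"
    using N by (intro AE_not_in null_setsI) auto
  have "AE x in lborel. \<forall>j<12. (real j - real (t j)) / 12 + (1/3) * x \<notin> N"
    using N(3) by (subst AE_all_countable) (intro allI AE_impI AE_borel_affine N0, auto)
  thus ?thesis unfolding AE_leb1_iff
  proof eventually_elim
    case (elim x)
    show ?case
    proof
      assume x: "x \<in> {0..<1}"
      have "indicator (quarter (t j)) x * f (x / 3 + (real j - real (t j)) / 12) =
         indicator (quarter (t j)) x * g (x / 3 + (real j - real (t j)) / 12)" if j: "j < 12" for j
      proof (cases "x \<in> quarter (t j)")
        case True
        then obtain u where u: "0 \<le> u" "u < 1" "x = (real (t j) + u) / 4" by (auto simp: in_quarter_iff)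
        have e: "x / 3 + (real j - real (t j)) / 12 = (real j + u) / 12" by (simp add: u field_simps)
        have "real j \<le> 11" using j by simp
        hence "(real j + u) / 12 \<in> {0..<1}" using u by auto
        moreover have "(real j + u) / 12 \<notin> N" using elim j unfolding e[symmetric] by (simp add: add.commute)
        ultimately have "f ((real j + u) / 12) = g ((real j + u) / 12)"
          using N(1) unfolding space_lborel space_borel by blast
        thus ?thesis unfolding e by simp
      qed simp
      hence "(\<Sum>j<12. indicator (quarter (t j)) x * f (x / 3 + (real j - real (t j)) / 12))
          = (\<Sum>j<12. indicator (quarter (t j)) x * g (x / 3 + (real j - real (t j)) / 12))"
        by (intro sum.cong) auto
      thus "PF (smap t) f x = PF (smap t) g x"
        unfolding PF_smap_at[OF t x] by simp
    qed
  qed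
qed

lemma PF_smap_measurable:
  assumes t: "balanced t" and f: "f \<in> borel_measurable leb1"
  shows "PF (smap t) f \<in> borel_measurable leb1"
proof -
  \<comment> \<open>Inverse branches that are switched off may leave the circle; extension by zero
    makes \<open>f\<close> a Borel function on the whole line.\<close>
  define F where "F x = indicator {0..<1} x * f x" for x
  have F [measurable]: "F \<in> borel_measurable borel"
    using f unfolding F_def leb1_def
    by (subst (asm) borel_measurable_restrict_space_iff) (auto simp: mult.commute)
  have "(\<lambda>x. (\<Sum>j<12. indicator (quarter (t j)) x * F (x / 3 + (real j - real (t j)) / 12)) / 3) \<in> borel_measurable borel"
    by measurable
  hence "(\<lambda>x. (\<Sum>j<12. indicator (quarter (t j)) x * F (x / 3 + (real j - real (t j)) / 12)) / 3) \<in> borel_measurable leb1"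
    unfolding leb1_def by (intro measurable_restrict_space1) simp
  moreover have "PF (smap t) f x = (\<Sum>j<12. indicator (quarter (t j)) x * F (x / 3 + (real j - real (t j)) / 12)) / 3"
    if x: "x \<in> space leb1" for x
  proof -
    have "indicator (quarter (t j)) x * f (x / 3 + (real j - real (t j)) / 12) =
         indicator (quarter (t j)) x * F (x / 3 + (real j - real (t j)) / 12)" if j: "j < 12" for j
    proof (cases "x \<in> quarter (t j)")
      case True
      then obtain u where u: "0 \<le> u" "u < 1" "x = (real (t j) + u) / 4" by (auto simp: in_quarter_iff)
      have e: "x / 3 + (real j - real (t j)) / 12 = (real j + u) / 12" by (simp add: u field_simps)
      have "real j \<le> 11" using j by simp
      hence "(real j + u) / 12 \<in> {0..<1}" using u by auto
      thus ?thesis unfolding e F_def by simp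
    qed simp
    hence "(\<Sum>j<12. indicator (quarter (t j)) x * f (x / 3 + (real j - real (t j)) / 12))
        = (\<Sum>j<12. indicator (quarter (t j)) x * F (x / 3 + (real j - real (t j)) / 12))"
      by (intro sum.cong) auto
    thus ?thesis using x PF_smap_at[OF t, of x f] by simp
  qed
  ultimately show ?thesis by (subst measurable_cong)
qed

section \<open>Variation dominated on each quarter\<close>

text \<open>\<open>dominates q h\<close>: on each quarter, with coordinate \<open>u \<in> [0, 1)\<close>, the increments of \<open>h\<close> are
  bounded by those of the monotone function \<open>q k\<close>. The value \<open>q k 1\<close> at the right endpoint makes
  the total increments telescope exactly under \<open>push\<close>.\<close>

definition dominates :: "(nat \<Rightarrow> real \<Rightarrow> real) \<Rightarrow> (real \<Rightarrow> real) \<Rightarrow> bool" where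
  "dominates q h \<longleftrightarrow>
     (\<forall>k<4. \<forall>u v. 0 \<le> u \<longrightarrow> u \<le> v \<longrightarrow> v \<le> 1 \<longrightarrow> q k u \<le> q k v) \<and>
     (\<forall>k<4. \<forall>u v. 0 \<le> u \<longrightarrow> u \<le> v \<longrightarrow> v < 1 \<longrightarrow>
        \<bar>h ((real k + v) / 4) - h ((real k + u) / 4)\<bar> \<le> q k v - q k u)"

definition spread :: "(nat \<Rightarrow> real \<Rightarrow> real) \<Rightarrow> real" where
  "spread q = (\<Sum>k<4. q k 1 - q k 0)"

definition push :: "(nat \<Rightarrow> nat) \<Rightarrow> (nat \<Rightarrow> real \<Rightarrow> real) \<Rightarrow> nat \<Rightarrow> real \<Rightarrow> real" where
  "push t q k u = (\<Sum>j | j < 12 \<and> t j = k. q (j div 3) ((real (j mod 3) + u) / 3)) / 3"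

lemma dominates_mono: "dominates q h \<Longrightarrow> k < 4 \<Longrightarrow> 0 \<le> u \<Longrightarrow> u \<le> v \<Longrightarrow> v \<le> 1 \<Longrightarrow> q k u \<le> q k v"
  by (simp add: dominates_def)

lemma dominates_diff:
  "dominates q h \<Longrightarrow> k < 4 \<Longrightarrow> 0 \<le> u \<Longrightarrow> u \<le> v \<Longrightarrow> v < 1 \<Longrightarrow>
    \<bar>h ((real k + v) / 4) - h ((real k + u) / 4)\<bar> \<le> q k v - q k u"
  unfolding dominates_def by blast

lemma mod3_le: "real (j mod 3) \<le> 2"
  by (simp add: less_Suc_eq_le[symmetric])

text \<open>Triangle inequality branch by branch: the inverse branches over quarter \<open>k\<close>
  preserve the order of \<open>u\<close> and \<open>v\<close>, so each increment is bounded by that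
  of the majorant on the corresponding third.\<close>

lemma dominates_push:
  assumes t: "balanced t" and d: "dominates q h"
  shows "dominates (push t q) (PF (smap t) h)"
  unfolding dominates_def
proof (intro conjI allI impI)
  fix k :: nat and u v :: real assume k: "k < 4" and uv: "0 \<le> u" "u \<le> v" "v \<le> 1"
  show "push t q k u \<le> push t q k v"
    unfolding push_def
  proof (intro divide_right_mono sum_mono dominates_mono[OF d])
    fix j show "(real (j mod 3) + v) / 3 \<le> 1" using mod3_le[of j] uv by simp
  qed (use uv in auto)
next
  fix k :: nat and u v :: real assume k: "k < 4" and uv: "0 \<le> u" "u \<le> v" "v < 1"
  have u1: "u < 1" and v0: "0 \<le> v" using uv by auto
  let ?J = "{j. j < 12 \<and> t j = k}"
  have "\<bar>PF (smap t) h ((real k + v) / 4) - PF (smap t) h ((real k + u) / 4)\<bar>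
      = \<bar>\<Sum>j\<in>?J. h ((real j + v) / 12) - h ((real j + u) / 12)\<bar> / 3"
    unfolding PF_smap[OF t k uv(1) u1] PF_smap[OF t k v0 uv(3)]
    by (simp add: sum_subtractf flip: diff_divide_distrib)
  also have "\<dots> \<le> (\<Sum>j\<in>?J. q (j div 3) ((real (j mod 3) + v) / 3) - q (j div 3) ((real (j mod 3) + u) / 3)) / 3"
  proof (intro divide_right_mono order_trans[OF sum_abs] sum_mono)
    fix j assume "j \<in> ?J"
    hence j: "j div 3 < 4" by auto
    show "\<bar>h ((real j + v) / 12) - h ((real j + u) / 12)\<bar>
        \<le> q (j div 3) ((real (j mod 3) + v) / 3) - q (j div 3) ((real (j mod 3) + u) / 3)"
      unfolding twelfth_in_quarter[of j]
      using uv twelfth_sub[of v j] by (intro dominates_diff[OF d j]) auto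
  qed simp
  also have "\<dots> = push t q k v - push t q k u"
    by (simp add: push_def sum_subtractf diff_divide_distrib)
  finally show "\<bar>PF (smap t) h ((real k + v) / 4) - PF (smap t) h ((real k + u) / 4)\<bar>
      \<le> push t q k v - push t q k u" .
qed

lemma sum_fibres_all:
  fixes f :: "nat \<Rightarrow> 'a :: comm_monoid_add"
  assumes "balanced t"
  shows "(\<Sum>k<4. \<Sum>j | j < 12 \<and> t j = k. f j) = (\<Sum>j<12. f j)"
proof -
  have "(\<Sum>k<4. \<Sum>j\<in>{j\<in>{..<12}. t j = k}. f j) = (\<Sum>j<12. f j)"
    using assms by (intro sum.group) (auto simp: balanced_def)
  thus ?thesis by simp
qed

text \<open>Every twelfth feeds exactly one quarter with weight 1/3, and the increments over the
  three thirds of a quarter telescope to its total increment.\<close>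

lemma spread_push:
  assumes "balanced t"
  shows "spread (push t q) = spread q / 3"
proof -
  have "spread (push t q) = (\<Sum>k<4. (\<Sum>j | j < 12 \<and> t j = k.
      q (j div 3) ((real (j mod 3) + 1) / 3) - q (j div 3) ((real (j mod 3) + 0) / 3)) / 3)"
    by (simp add: spread_def push_def sum_subtractf diff_divide_distrib)
  also have "\<dots> = (\<Sum>j<12. q (j div 3) ((real (j mod 3) + 1) / 3) - q (j div 3) ((real (j mod 3) + 0) / 3)) / 3"
    by (simp only: sum_fibres_all[OF assms] flip: sum_divide_distrib)
  also have "(\<Sum>j<12. q (j div 3) ((real (j mod 3) + 1) / 3) - q (j div 3) ((real (j mod 3) + 0) / 3)) = spread q"
    by (simp add: spread_def lessThan_nat_numeral)
  finally show ?thesis .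
qed

lemma osc_le_spread:
  assumes d: "dominates q h" and k: "k < 4" and u: "0 \<le> u" "u \<le> 1"
  shows "q k u - q k 0 \<le> spread q"
proof -
  have "q k u \<le> q k 1" using dominates_mono[OF d k u(1)] u by simp
  moreover have "q k 1 - q k 0 \<le> spread q"
    unfolding spread_def using dominates_mono[OF d] k by (intro member_le_sum) auto
  ultimately show ?thesis by simp
qed

lemma spread_nonneg: "dominates q h \<Longrightarrow> 0 \<le> spread q"
  using osc_le_spread[of q h 0 0] by simp

lemma dominates_osc:
  assumes d: "dominates q h" and k: "k < 4" and u: "0 \<le> u" "u < 1"
  shows "\<bar>h ((real k + u) / 4) - h (real k / 4)\<bar> \<le> spread q"
  using dominates_diff[OF d k order_refl u] osc_le_spread[OF d k u(1)] u by simp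

lemma dominates_bounded:
  assumes d: "dominates q h" and K: "\<And>k. k < 4 \<Longrightarrow> \<bar>h (real k / 4)\<bar> \<le> K" and x: "x \<in> {0..<1}"
  shows "\<bar>h x\<bar> \<le> K + spread q"
proof -
  obtain k u where ku: "k < 4" "0 \<le> u" "u < 1" "x = (real k + u) / 4"
    using x quarter_ex by auto
  show ?thesis using dominates_osc[OF d ku(1-3)] K[OF ku(1)] unfolding ku(4) by linarith
qed

section \<open>Majorants compared with the BV norm\<close>

text \<open>A single increasing function \<open>Q\<close> on the circle cut at 0 controls all
  increments of \<open>h\<close>, so the variation sum telescopes; the closing increment from the
  last point to the first is bounded separately.\<close>

lemma circle_var_le:
  assumes d: "dominates q h" and K: "\<And>k. k < 4 \<Longrightarrow> \<bar>h (real k / 4)\<bar> \<le> K"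
  shows "circle_var h \<le> ereal (8 * K + 12 * spread q)"
proof -
  define L where "L = K + spread q"
  have tot: "0 \<le> spread q" using d by (rule spread_nonneg)
  have hL: "\<bar>h x\<bar> \<le> L" if "x \<in> {0..<1}" for x
    unfolding L_def using dominates_bounded[OF d K that] .
  have L0: "0 \<le> L" using hL[of 0] by simp
  define idx where "idx x = nat \<lfloor>4 * x\<rfloor>" for x :: real
  \<comment> \<open>The jump between consecutive quarters has two parts: \<open>2 * L\<close> pays
    for any increment of \<open>h\<close>, and \<open>spread q\<close> for the reset of the part of
    \<open>Q\<close> inside the quarter.\<close>
  define Q where "Q x = q (idx x) (frac (4 * x)) - q (idx x) 0 + (2 * L + spread q) * real (idx x)" for x
  have idx: "idx x < 4" "x = (real (idx x) + frac (4 * x)) / 4" if "x \<in> {0..<1}" for x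
  proof -
    show "idx x < 4" using that unfolding idx_def by auto linarith
    show "x = (real (idx x) + frac (4 * x)) / 4"
      using that by (simp add: idx_def frac_def)
  qed
  have part: "0 \<le> q (idx x) (frac (4 * x)) - q (idx x) 0" "q (idx x) (frac (4 * x)) - q (idx x) 0 \<le> spread q"
    if "x \<in> {0..<1}" for x
    using dominates_mono[OF d idx(1)[OF that], of 0 "frac (4 * x)"]
      osc_le_spread[OF d idx(1)[OF that], of "frac (4 * x)"] frac_lt_1[of "4 * x"] by auto
  have Qb: "0 \<le> Q x \<and> Q x \<le> 6 * L + 4 * spread q" if x: "x \<in> {0..<1}" for x
  proof
    show "0 \<le> Q x" unfolding Q_def using part[OF x] tot L0 by simp
    have "real (idx x) \<le> 3" using idx(1)[OF x] by simp
    hence "(2 * L + spread q) * real (idx x) \<le> (2 * L + spread q) * 3"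
      using tot L0 by (intro mult_left_mono) auto
    thus "Q x \<le> 6 * L + 4 * spread q" unfolding Q_def using part[OF x] by simp
  qed
  have Qd: "\<bar>h y - h x\<bar> \<le> Q y - Q x" if x: "x \<in> {0..<1}" and y: "y \<in> {0..<1}" and xy: "x \<le> y" for x y
  proof (cases "idx x = idx y")
    case True
    have "frac (4 * x) \<le> frac (4 * y)" using idx(2)[OF x] idx(2)[OF y] True xy by simp
    hence "\<bar>h ((real (idx x) + frac (4 * y)) / 4) - h ((real (idx x) + frac (4 * x)) / 4)\<bar>
        \<le> q (idx x) (frac (4 * y)) - q (idx x) (frac (4 * x))"
      by (intro dominates_diff[OF d idx(1)[OF x]]) (auto simp: frac_lt_1)
    moreover have "(real (idx x) + frac (4 * y)) / 4 = y" "(real (idx x) + frac (4 * x)) / 4 = x"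
      using idx(2)[OF x] idx(2)[OF y] True by simp_all
    ultimately show ?thesis using True by (simp only: Q_def)
  next
    case False
    have "idx x \<le> idx y" unfolding idx_def using xy by (intro nat_mono floor_mono) simp
    with False have "real (idx x) + 1 \<le> real (idx y)" by simp
    hence "(2 * L + spread q) * (real (idx x) + 1) \<le> (2 * L + spread q) * real (idx y)"
      using tot L0 by (intro mult_left_mono) auto
    moreover have "\<bar>h y - h x\<bar> \<le> 2 * L" using hL[OF x] hL[OF y] by linarith
    ultimately show ?thesis
      unfolding Q_def using part[OF x] part[OF y] by (simp add: algebra_simps)
  qed
  have "(\<Sum>j<length xs. \<bar>h (xs ! ((j + 1) mod length xs)) - h (xs ! j)\<bar>) \<le> 8 * L + 4 * spread q"
    if xs: "sorted_wrt (<) xs" "set xs \<subseteq> {0..<1}" for xs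
  proof (cases "length xs")
    case 0
    thus ?thesis using L0 tot by simp
  next
    case (Suc m)
    have mem: "xs ! j \<in> {0..<1}" if "j \<le> m" for j
      using subsetD[OF xs(2) nth_mem[of j xs]] Suc that by simp
    have "(\<Sum>j<m. \<bar>h (xs ! ((j + 1) mod length xs)) - h (xs ! j)\<bar>) \<le> (\<Sum>j<m. Q (xs ! Suc j) - Q (xs ! j))"
    proof (rule sum_mono)
      fix j assume j: "j \<in> {..<m}"
      have "xs ! j < xs ! Suc j" using sorted_wrt_nth_less[OF xs(1), of j "Suc j"] j Suc by simp
      hence "\<bar>h (xs ! Suc j) - h (xs ! j)\<bar> \<le> Q (xs ! Suc j) - Q (xs ! j)"
        using j by (intro Qd mem) auto
      moreover have "(j + 1) mod length xs = Suc j" using j Suc by simp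
      ultimately show "\<bar>h (xs ! ((j + 1) mod length xs)) - h (xs ! j)\<bar> \<le> Q (xs ! Suc j) - Q (xs ! j)"
        by simp
    qed
    also have "\<dots> = Q (xs ! m) - Q (xs ! 0)" by (rule sum_lessThan_telescope)
    also have "\<dots> \<le> 6 * L + 4 * spread q" using Qb[OF mem[of m]] Qb[OF mem[of 0]] by simp
    finally have 1: "(\<Sum>j<m. \<bar>h (xs ! ((j + 1) mod length xs)) - h (xs ! j)\<bar>) \<le> 6 * L + 4 * spread q" .
    \<comment> \<open>The index wraps around to 0, which gives the closing increment.\<close>
    have "\<bar>h (xs ! ((m + 1) mod length xs)) - h (xs ! m)\<bar> \<le> 2 * L"
      using hL[OF mem[of m]] hL[OF mem[of 0]] Suc by simp
    thus ?thesis using 1 by (simp add: Suc)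
  qed
  hence "circle_var h \<le> ereal (8 * L + 4 * spread q)"
    unfolding circle_var_def by (intro SUP_least) auto
  thus ?thesis by (simp add: L_def algebra_simps)
qed

text \<open>The running variation \<open>W\<close>, taken over finite chains that end at the given
  point, majorizes the increments of \<open>g\<close>; its restrictions to the quarters serve as
  \<open>q\<close>.\<close>

lemma ex_dominates:
  assumes "circle_var g < \<infinity>"
  shows "\<exists>q. dominates q g"
proof -
  obtain C where C: "circle_var g \<le> ereal C"
    using assms by (cases "circle_var g") auto
  define s where "s xs = (\<Sum>j<length xs - 1. \<bar>g (xs ! Suc j) - g (xs ! j)\<bar>)" for xs :: "real list"
  \<comment> \<open>Prescribing the last point lets a chain ending at \<open>x\<close> be prolonged
    by any later \<open>y\<close>, with a gain of exactly one increment.\<close>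
  define lists_to where "lists_to x = {xs. sorted_wrt (<) xs \<and> set xs \<subseteq> {0..<1} \<and> xs \<noteq> [] \<and> last xs = x}" for x :: real
  define W where "W x = (SUP xs\<in>lists_to x. s xs)" for x
  have sC: "s xs \<le> C" if "xs \<in> lists_to x" for xs x
  proof -
    have xs: "sorted_wrt (<) xs" "set xs \<subseteq> {0..<1}" "xs \<noteq> []" using that by (auto simp: lists_to_def)
    have "s xs = (\<Sum>j<length xs - 1. \<bar>g (xs ! ((j + 1) mod length xs)) - g (xs ! j)\<bar>)"
      unfolding s_def by (intro sum.cong) auto
    \<comment> \<open>The circular sum has one further nonnegative term, the closing
      increment.\<close>
    also have "\<dots> \<le> (\<Sum>j<length xs. \<bar>g (xs ! ((j + 1) mod length xs)) - g (xs ! j)\<bar>)"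
      by (intro sum_mono2) auto
    finally have "ereal (s xs) \<le> ereal (\<Sum>j<length xs. \<bar>g (xs ! ((j + 1) mod length xs)) - g (xs ! j)\<bar>)"
      by simp
    also have "\<dots> \<le> circle_var g"
      unfolding circle_var_def by (rule SUP_upper) (use xs in auto)
    finally show ?thesis using C by (meson ereal_less_eq(3) order_trans)
  qed
  have ne: "lists_to x \<noteq> {}" if "x \<in> {0..<1}" for x
    using that by (auto simp: lists_to_def intro!: exI[of _ "[x]"])
  have bdd: "bdd_above (s ` lists_to x)" for x
    using sC by (auto simp: bdd_above_def)
  have WC: "W x \<le> C" if "x \<in> {0..<1}" for x
    unfolding W_def using ne[OF that] sC by (intro cSUP_least) auto
  have Wd: "\<bar>g y - g x\<bar> \<le> W y - W x" if x: "x \<in> {0..<1}" and y: "y \<in> {0..<1}" and xy: "x < y" for x y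
  proof -
    have "W x \<le> W y - \<bar>g y - g x\<bar>"
      unfolding W_def[of x]
    proof (rule cSUP_least[OF ne[OF x]])
      fix xs assume xs: "xs \<in> lists_to x"
      obtain ys where "xs = ys @ [x]"
        using xs by (auto simp: lists_to_def) (metis append_butlast_last_id)
      hence le: "z \<le> x" if "z \<in> set xs" for z
        using that xs by (auto simp: lists_to_def sorted_wrt_append)
      have mem: "xs @ [y] \<in> lists_to y"
        using xs y xy le by (auto simp: lists_to_def sorted_wrt_append intro: le_less_trans)
      obtain m where m: "length xs = Suc m" using xs by (cases xs) (auto simp: lists_to_def)
      have "s (xs @ [y]) = (\<Sum>j<Suc m. \<bar>g ((xs @ [y]) ! Suc j) - g ((xs @ [y]) ! j)\<bar>)"
        by (simp add: s_def m)
      also have "\<dots> = (\<Sum>j<m. \<bar>g ((xs @ [y]) ! Suc j) - g ((xs @ [y]) ! j)\<bar>) + \<bar>g y - g (xs ! m)\<bar>"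
        using m by (simp add: nth_append)
      also have "(\<Sum>j<m. \<bar>g ((xs @ [y]) ! Suc j) - g ((xs @ [y]) ! j)\<bar>) = s xs"
        unfolding s_def m by (intro sum.cong) (auto simp: nth_append m)
      also have "xs ! m = x" using xs m by (auto simp: lists_to_def last_conv_nth)
      finally have "s xs + \<bar>g y - g x\<bar> = s (xs @ [y])" by simp
      also have "\<dots> \<le> W y" unfolding W_def by (rule cSUP_upper[OF mem bdd])
      finally show "s xs \<le> W y - \<bar>g y - g x\<bar>" by simp
    qed
    thus ?thesis by simp
  qed
  have in01: "(real k + u) / 4 \<in> {0..<1}" if "k < 4" "0 \<le> u" "u < 1" for k u
  proof -
    have "real k \<le> 3" using that by simp
    thus ?thesis using that by simp
  qed
  have Wd': "\<bar>g ((real k + v) / 4) - g ((real k + u) / 4)\<bar> \<le> W ((real k + v) / 4) - W ((real k + u) / 4)"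
    if "k < 4" "0 \<le> u" "u \<le> v" "v < 1" for k u v
    using that Wd[of "(real k + u) / 4" "(real k + v) / 4"] in01[of k u] in01[of k v]
    by (cases "u = v") auto
  \<comment> \<open>At \<open>u = 1\<close> the common bound \<open>C\<close> replaces
    \<open>W\<close>: it exceeds all values of \<open>W\<close> on the circle and avoids evaluating
    \<open>W\<close> at 1, where no chain ends.\<close>
  have "dominates (\<lambda>k u. if u < 1 then W ((real k + u) / 4) else C) g"
    unfolding dominates_def
  proof (intro conjI allI impI)
    fix k :: nat and u v :: real assume *: "k < 4" "0 \<le> u" "u \<le> v" "v \<le> 1"
    show "(if u < 1 then W ((real k + u) / 4) else C) \<le> (if v < 1 then W ((real k + v) / 4) else C)"
    proof (cases "v < 1")
      case True
      thus ?thesis using Wd'[of k u v] * by auto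
    next
      case False
      thus ?thesis using WC[OF in01] * by auto
    qed
  qed (use Wd' in auto)
  thus ?thesis by blast
qed

lemma bv_norm_le:
  assumes fh: "AE x in leb1. f x = h x" and d: "dominates q h"
    and K: "\<And>k. k < 4 \<Longrightarrow> \<bar>h (real k / 4)\<bar> \<le> K"
  shows "bv_norm f \<le> 8 * K + 12 * spread q"
proof -
  have tot: "0 \<le> spread q" using d by (rule spread_nonneg)
  have K0: "0 \<le> K" using K[of 0] by simp
  interpret finite_measure leb1 by (rule finite_measure_leb1)
  have "(\<integral>x. \<bar>f x\<bar> \<partial>leb1) \<le> K + spread q"
  proof (cases "integrable leb1 (\<lambda>x. \<bar>f x\<bar>)")
    case True
    have "AE x in leb1. \<bar>f x\<bar> \<le> K + spread q"
      using fh AE_space by eventually_elim (use dominates_bounded[OF d K] in auto)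
    hence "(\<integral>x. \<bar>f x\<bar> \<partial>leb1) \<le> (\<integral>x. K + spread q \<partial>leb1)"
      using True by (intro integral_mono_AE) auto
    also have "\<dots> = K + spread q" using measure_leb1_space by simp
    finally show ?thesis .
  next
    case False
    \<comment> \<open>The integral of a non-integrable function is 0 by convention, below the
      nonnegative bound.\<close>
    thus ?thesis using tot K0 by (simp add: not_integrable_integral_eq)
  qed
  moreover have "bv_var f \<le> circle_var h"
    unfolding bv_var_def by (rule INF_lower) (use fh in auto)
  hence "bv_var f \<le> ereal (8 * K + 12 * spread q)"
    using circle_var_le[OF d K] by (rule order_trans)
  hence "real_of_ereal (bv_var f) \<le> 8 * K + 12 * spread q"
    using tot K0 by (cases "bv_var f") auto
  ultimately show ?thesis using tot K0 by (simp add: bv_norm_def)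
qed

text \<open>The integral alone gives the bound: on quarter \<open>k\<close>, of measure 1/4,
  \<open>h\<close> stays within \<open>spread q\<close> of its value at the left endpoint.\<close>

lemma bv_norm_ge:
  assumes f [measurable]: "f \<in> borel_measurable leb1" and fh: "AE x in leb1. f x = h x"
    and d: "dominates q h" and k: "k < 4"
  shows "(\<bar>h (real k / 4)\<bar> - spread q) / 4 \<le> bv_norm f"
proof -
  interpret finite_measure leb1 by (rule finite_measure_leb1)
  define K where "K = Max ((\<lambda>k. \<bar>h (real k / 4)\<bar>) ` {..<4::nat})"
  have K: "\<bar>h (real k / 4)\<bar> \<le> K" if "k < 4" for k
    unfolding K_def using that by (intro Max_ge) auto
  have int: "integrable leb1 (\<lambda>x. \<bar>f x\<bar>)"
  proof (rule integrable_const_bound[of _ "K + spread q"])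
    show "AE x in leb1. norm \<bar>f x\<bar> \<le> K + spread q"
      using fh AE_space by eventually_elim (use dominates_bounded[OF d K] in auto)
  qed simp
  have q1: "quarter k \<in> sets leb1"
    using quarter_subset[OF k] by (simp add: leb1_def sets_restrict_space_iff)
  have "measure leb1 (quarter k) = 1 / 4"
    using quarter_subset[OF k] by (simp add: leb1_def measure_restrict_space) (simp add: quarter_def add_divide_distrib)
  hence "(\<bar>h (real k / 4)\<bar> - spread q) / 4 = (\<integral>x. (\<bar>h (real k / 4)\<bar> - spread q) * indicator (quarter k) x \<partial>leb1)"
    using q1 quarter_subset[OF k] by (simp add: Int_absorb2)
  also have "\<dots> \<le> (\<integral>x. \<bar>f x\<bar> \<partial>leb1)"
  proof (rule integral_mono_AE[OF _ int])
    show "integrable leb1 (\<lambda>x. (\<bar>h (real k / 4)\<bar> - spread q) * indicator (quarter k) x)"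
      using q1 by (intro integrable_mult_right integrable_real_indicator) (auto simp: less_top[symmetric])
    show "AE x in leb1. (\<bar>h (real k / 4)\<bar> - spread q) * indicator (quarter k) x \<le> \<bar>f x\<bar>"
      using fh
    proof eventually_elim
      case (elim x)
      show ?case
      proof (cases "x \<in> quarter k")
        case True
        then obtain u where u: "0 \<le> u" "u < 1" "x = (real k + u) / 4" by (auto simp: in_quarter_iff)
        show ?thesis using dominates_osc[OF d k u(1,2)] True elim unfolding u(3) by simp
      qed simp
    qed
  qed
  also have "\<dots> \<le> bv_norm f" by (simp add: bv_norm_def)
  finally show ?thesis .
qed

section \<open>Transition matrices and cocycles\<close>

text \<open>Three times the operator on functions constant on quarters; the matrix entry at
  \<open>k\<close>, \<open>i\<close> counts the twelfths of quarter \<open>i\<close> sent to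
  \<open>k\<close>. The value type is open because complex eigenvectors occur too.\<close>

definition transfer :: "(nat \<Rightarrow> nat) \<Rightarrow> (nat \<Rightarrow> 'a) \<Rightarrow> nat \<Rightarrow> 'a :: comm_monoid_add" where
  "transfer t v k = (\<Sum>j | j < 12 \<and> t j = k. v (j div 3))"

lemma vlift_quarter: "k < 4 \<Longrightarrow> 0 \<le> u \<Longrightarrow> u < 1 \<Longrightarrow> vlift 4 quarter v ((real k + u) / 4) = v k"
  by (simp add: vlift_def indicator_def quarter_unique if_distrib cong: if_cong)

lemma PF_step:
  assumes t: "balanced t" and k: "k < 4" "0 \<le> u" "u < 1"
    and f: "\<And>i x. i < 4 \<Longrightarrow> x \<in> quarter i \<Longrightarrow> f x = v i"
  shows "PF (smap t) f ((real k + u) / 4) = transfer t v k / 3"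
proof -
  have "f ((real j + u) / 12) = v (j div 3)" if "j < 12" for j
    using that twelfth_sub[OF k(2,3), of j]
    by (intro f) (auto simp only: twelfth_in_quarter[of j] quarter_unique less_mult_imp_div_less)
  thus ?thesis by (simp add: PF_smap[OF t k] transfer_def)
qed

text \<open>\<open>Amat\<close> is a definite description: existence is \<open>PF_step\<close> on
  each quarter, and uniqueness holds since no quarter is a null set.\<close>

lemma Amat_smap:
  assumes t: "balanced (\<tau> i)" and v: "v \<in> vecs 4"
  shows "Amat (\<lambda>i. smap (\<tau> i)) 4 quarter i v = (\<lambda>k. if k < 4 then transfer (\<tau> i) v k / 3 else 0)"
  unfolding Amat_def
proof (rule the_equality)
  let ?w = "\<lambda>k. if k < 4 then transfer (\<tau> i) v k / 3 else 0"
  have PFv: "PF (smap (\<tau> i)) (vlift 4 quarter v) x = vlift 4 quarter ?w x" if x: "x \<in> {0..<1}" for x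
  proof -
    obtain k u where ku: "k < 4" "0 \<le> u" "u < 1" "x = (real k + u) / 4"
      using x quarter_ex by auto
    have "vlift 4 quarter v y = v i" if "i < 4" "y \<in> quarter i" for i y
      using that vlift_quarter by (auto simp only: in_quarter_iff)
    hence "PF (smap (\<tau> i)) (vlift 4 quarter v) ((real k + u) / 4) = transfer (\<tau> i) v k / 3"
      by (rule PF_step[OF t ku(1-3)])
    thus ?thesis unfolding ku(4) vlift_quarter[OF ku(1-3)] using ku(1) by simp
  qed
  thus "?w \<in> vecs 4 \<and> (AE x in leb1. PF (smap (\<tau> i)) (vlift 4 quarter v) x = vlift 4 quarter ?w x)"
    by (auto simp: vecs_def intro!: AE_I2)
  fix w assume w: "w \<in> vecs 4 \<and> (AE x in leb1. PF (smap (\<tau> i)) (vlift 4 quarter v) x = vlift 4 quarter w x)"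
  have "AE x in leb1. vlift 4 quarter ?w x = vlift 4 quarter w x"
    using w[THEN conjunct2] AE_space by eventually_elim (use PFv in simp)
  have "w k = ?w k" for k
  proof (cases "k < 4")
    case True
    obtain x where "x \<in> quarter k" "vlift 4 quarter ?w x = vlift 4 quarter w x"
      using AE_leb1_quarter_ex[OF \<open>AE x in leb1. vlift 4 quarter ?w x = vlift 4 quarter w x\<close> True] .
    thus ?thesis using vlift_quarter[OF True, of _ ?w] vlift_quarter[OF True, of _ w]
      by (auto simp only: in_quarter_iff)
  qed (use w in \<open>auto simp: vecs_def\<close>)
  thus "w = ?w" by blast
qed

lemma dpow_smap:
  assumes "balanced t" "x \<in> {0..<1}"
  shows "dpow (smap t) n x = 3 ^ n"
proof -
  have "(smap t ^^ k) x \<in> {0..<1}" for k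
    by (induction k) (use assms smap_range in auto)
  thus ?thesis by (simp add: dpow_def cderiv_smap[OF assms(1)])
qed

lemma theta_map_smap:
  assumes "balanced t"
  shows "theta_map (smap t) = 1 / 3"
proof -
  have "(SUP x\<in>{0..<1}. \<bar>dpow (smap t) n x\<bar> powr (- 1 / real n)) = 1 / 3" if "n > 0" for n
  proof -
    have "(SUP x\<in>{0..<1}. \<bar>dpow (smap t) n x\<bar> powr (- 1 / real n)) = (SUP x\<in>{0..<1::real}. 1 / 3 :: real)"
    proof (intro SUP_cong refl)
      fix x :: real assume "x \<in> {0..<1}"
      hence "\<bar>dpow (smap t) n x\<bar> powr (- 1 / real n) = (3 powr real n) powr (- 1 / real n)"
        by (simp add: dpow_smap[OF assms] powr_realpow)
      also have "\<dots> = 1 / 3"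
        using that by (simp add: powr_powr powr_minus_divide)
      finally show "\<bar>dpow (smap t) n x\<bar> powr (- 1 / real n) = 1 / 3" .
    qed
    thus ?thesis by simp
  qed
  \<comment> \<open>The sequence is constant from \<open>n = 1\<close> on; at \<open>n = 0\<close>
    division by zero makes the exponent 0 and the value 1.\<close>
  hence "(\<lambda>n. SUP x\<in>{0..<1}. \<bar>dpow (smap t) n x\<bar> powr (- 1 / real n)) \<longlonglongrightarrow> 1 / 3"
    by (intro tendsto_eventually eventually_mono[OF eventually_gt_at_top[of 0]])
  thus ?thesis unfolding theta_map_def by (rule limI)
qed

section \<open>Cocycles of balanced maps\<close>

locale smap_cocycle =
  fixes \<tau> :: "nat \<Rightarrow> nat \<Rightarrow> nat" and \<omega> :: "int \<Rightarrow> nat"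
  assumes bal: "balanced (\<tau> (\<omega> k))"
begin

abbreviation S where "S i \<equiv> smap (\<tau> i)"

lemma mcoc_range: "x \<in> {0..<1} \<Longrightarrow> mcoc S \<omega> n x \<in> {0..<1}"
  by (induction n) (use smap_range[OF bal] in auto)

lemma dcoc_eq: "x \<in> {0..<1} \<Longrightarrow> dcoc S \<omega> n x = 3 ^ n"
  by (simp add: dcoc_def cderiv_smap[OF bal mcoc_range])

lemma ess_bound_eq: "ess_bound S \<omega> = ereal (ln (1 / 3))"
proof -
  have "limsup (\<lambda>n. ereal (1 / real n) * eln \<bar>dcoc S \<omega> n x\<bar>) = ereal (ln 3)" if "x \<in> {0..<1}" for x
  proof (rule lim_imp_Limsup)
    have "ereal (1 / real n) * eln \<bar>dcoc S \<omega> n x\<bar> = ereal (ln 3)" if "n > 0" for n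
      using that \<open>x \<in> {0..<1}\<close> by (simp add: dcoc_eq eln_def ln_realpow)
    thus "(\<lambda>n. ereal (1 / real n) * eln \<bar>dcoc S \<omega> n x\<bar>) \<longlonglongrightarrow> ereal (ln 3)"
      by (intro tendsto_eventually eventually_mono[OF eventually_gt_at_top[of 0]])
  qed simp
  hence "(INF x\<in>{0..<1}. limsup (\<lambda>n. ereal (1 / real n) * eln \<bar>dcoc S \<omega> n x\<bar>)) = (INF x\<in>{0..<1::real}. ereal (ln 3))"
    by (intro INF_cong) auto
  thus ?thesis by (simp add: ess_bound_def ln_div)
qed

lemma pcoc_cong_AE: "AE x in leb1. f x = g x \<Longrightarrow> AE x in leb1. pcoc S \<omega> n f x = pcoc S \<omega> n g x"
proof (induction n)
  case (Suc n)
  show ?case unfolding pcoc.simps by (rule PF_smap_cong_AE[OF bal Suc.IH[OF Suc.prems]])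
qed simp

lemma pcoc_measurable: "f \<in> borel_measurable leb1 \<Longrightarrow> pcoc S \<omega> n f \<in> borel_measurable leb1"
  by (induction n) (auto intro: PF_smap_measurable[OF bal])

lemma pcoc_dominated:
  assumes "dominates q g"
  shows "\<exists>q'. dominates q' (pcoc S \<omega> n g) \<and> spread q' = spread q / 3 ^ n"
proof (induction n)
  case 0
  show ?case using assms by auto
next
  case (Suc n)
  then obtain q' where "dominates q' (pcoc S \<omega> n g)" "spread q' = spread q / 3 ^ n" by blast
  hence "dominates (push (\<tau> (\<omega> (int n))) q') (pcoc S \<omega> (Suc n) g)"
      "spread (push (\<tau> (\<omega> (int n))) q') = spread q / 3 ^ Suc n"
    by (simp_all only: pcoc.simps dominates_push[OF bal] spread_push[OF bal]) simp
  thus ?case by blast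
qed

text \<open>By \<open>dominates_osc\<close>, the iterate differs on each quarter from its node value
  by at most the current spread, so these four numbers stand for the iterate.\<close>

definition nodes :: "(real \<Rightarrow> real) \<Rightarrow> nat \<Rightarrow> nat \<Rightarrow> real" where
  "nodes g n k = pcoc S \<omega> n g (real k / 4)"

text \<open>The new node value averages the iterate over left ends of twelfths. Moving each to the
  left end of its quarter costs at most the current spread, and three errors divided by 3 leave
  one.\<close>

lemma nodes_step:
  assumes d: "dominates q g" and k: "k < 4"
  shows "\<bar>nodes g (Suc n) k - transfer (\<tau> (\<omega> (int n))) (nodes g n) k / 3\<bar> \<le> spread q / 3 ^ n"
proof -
  let ?t = "\<tau> (\<omega> (int n))"
  let ?J = "{j. j < 12 \<and> ?t j = k}"
  obtain q' where q': "dominates q' (pcoc S \<omega> n g)" "spread q' = spread q / 3 ^ n"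
    using pcoc_dominated[OF d] by blast
  have "nodes g (Suc n) k = (\<Sum>j\<in>?J. pcoc S \<omega> n g ((real j + 0) / 12)) / 3"
    unfolding nodes_def using PF_smap[OF bal k, of 0] by simp
  hence "\<bar>nodes g (Suc n) k - transfer ?t (nodes g n) k / 3\<bar>
      = \<bar>\<Sum>j\<in>?J. pcoc S \<omega> n g ((real j + 0) / 12) - nodes g n (j div 3)\<bar> / 3"
    unfolding transfer_def sum_subtractf by (simp only: abs_divide flip: diff_divide_distrib)
  also have "\<dots> \<le> (\<Sum>j\<in>?J. spread q / 3 ^ n) / 3"
  proof (intro divide_right_mono order_trans[OF sum_abs] sum_mono)
    fix j assume "j \<in> ?J"
    hence "j div 3 < 4" by auto
    thus "\<bar>pcoc S \<omega> n g ((real j + 0) / 12) - nodes g n (j div 3)\<bar> \<le> spread q / 3 ^ n"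
      unfolding nodes_def twelfth_in_quarter[of j] q'(2)[symmetric]
      using twelfth_sub[of 0 j] by (intro dominates_osc[OF q'(1)]) auto
  qed simp
  also have "\<dots> = spread q / 3 ^ n"
    using bal[of "int n"] k by (simp add: balanced_def)
  finally show ?thesis .
qed

lemma bv_norm_pcoc_le:
  assumes fg: "AE x in leb1. f x = g x" and d: "dominates q g"
    and K: "\<And>k. k < 4 \<Longrightarrow> \<bar>nodes g n k\<bar> \<le> K"
  shows "bv_norm (pcoc S \<omega> n f) \<le> 8 * K + 12 * (spread q / 3 ^ n)"
proof -
  obtain q' where q': "dominates q' (pcoc S \<omega> n g)" "spread q' = spread q / 3 ^ n"
    using pcoc_dominated[OF d] by blast
  show ?thesis
    using bv_norm_le[OF pcoc_cong_AE[OF fg] q'(1)] K unfolding q'(2) nodes_def by blast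
qed

lemma bv_norm_pcoc_ge:
  assumes f: "f \<in> borel_measurable leb1" and fg: "AE x in leb1. f x = g x"
    and d: "dominates q g" and k: "k < 4"
  shows "\<bar>nodes g n k\<bar> \<le> 4 * bv_norm (pcoc S \<omega> n f) + spread q / 3 ^ n"
proof -
  obtain q' where q': "dominates q' (pcoc S \<omega> n g)" "spread q' = spread q / 3 ^ n"
    using pcoc_dominated[OF d] by blast
  show ?thesis
    using bv_norm_ge[OF pcoc_measurable[OF f] pcoc_cong_AE[OF fg] q'(1) k] unfolding nodes_def q'(2)
    by simp
qed

end

section \<open>Perturbed recurrences and growth rates\<close>

lemma bv_norm_nonneg: "0 \<le> bv_norm f"
  unfolding bv_norm_def by (rule max.coboundedI1) simp

text \<open>The increments of \<open>a n / m ^ n\<close> are bounded by a geometric sequence of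
  ratio \<open>1 / (3 * m) < 1\<close>, hence there is a limit \<open>L\<close>; the tail multiplied
  by \<open>m ^ n\<close> is again of order \<open>1 / 3 ^ n\<close>.\<close>

lemma perturbed_recurrence_converges:
  fixes a :: "nat \<Rightarrow> real"
  assumes step: "\<And>n. \<bar>a (Suc n) - m * a n\<bar> \<le> D / 3 ^ n" and m: "m > 1 / 3"
  shows "\<exists>L C. \<forall>n. \<bar>a n - L * m ^ n\<bar> \<le> C / 3 ^ n"
proof -
  define r where "r = 1 / (3 * m)"
  have r: "0 < r" "r < 1" using m by (auto simp: r_def field_simps)
  have m0: "m > 0" using m by simp
  define d where "d n = a (Suc n) / m ^ Suc n - a n / m ^ n" for n
  have dn: "\<bar>d n\<bar> \<le> D / m * r ^ n" for n
  proof -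
    have "\<bar>d n\<bar> = \<bar>a (Suc n) - m * a n\<bar> / m ^ Suc n"
      using m0 by (simp add: d_def field_simps flip: abs_divide[of _ "m ^ Suc n"])
    also have "\<dots> \<le> D / 3 ^ n / m ^ Suc n"
      using m0 by (intro divide_right_mono step) auto
    also have "\<dots> = D / m * r ^ n" by (simp add: r_def power_divide power_mult_distrib)
    finally show ?thesis .
  qed
  have sg: "summable (\<lambda>n. D / m * r ^ n)"
    using r by (intro summable_mult summable_geometric) auto
  have sd: "summable d"
    by (rule summable_comparison_test'[OF sg, of 0]) (use dn in auto)
  define L where "L = a 0 + suminf d"
  have "\<bar>a n - L * m ^ n\<bar> \<le> (D / m / (1 - r)) / 3 ^ n" for n
  proof -
    have "a n / m ^ n = a 0 + (\<Sum>k<n. d k)"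
      unfolding d_def by (subst sum_lessThan_telescope) simp
    hence "L - a n / m ^ n = (\<Sum>k. d (k + n))"
      using suminf_minus_initial_segment[OF sd, of n] by (simp add: L_def)
    also have "\<bar>\<dots>\<bar> \<le> (\<Sum>k. D / m * r ^ (k + n))"
    proof -
      have sgn: "summable (\<lambda>k. D / m * r ^ (k + n))"
        using sg by (subst summable_iff_shift[of "\<lambda>k. D / m * r ^ k"])
      hence "summable (\<lambda>k. \<bar>d (k + n)\<bar>)"
        by (rule summable_comparison_test'[of _ 0]) (use dn in auto)
      moreover from this sgn have "(\<Sum>k. \<bar>d (k + n)\<bar>) \<le> (\<Sum>k. D / m * r ^ (k + n))"
        using dn by (intro suminf_le)
      ultimately show ?thesis using summable_rabs[of "\<lambda>k. d (k + n)"] by simp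
    qed
    also have "\<dots> = (\<Sum>k. (D / m * r ^ n) * r ^ k)" by (simp add: power_add mult_ac)
    also have "\<dots> = (D / m * r ^ n) * (1 / (1 - r))"
      using r by (subst suminf_mult) (auto simp: suminf_geometric)
    finally have "\<bar>L - a n / m ^ n\<bar> \<le> (D / m * r ^ n) * (1 / (1 - r))" .
    hence "\<bar>L - a n / m ^ n\<bar> * m ^ n \<le> (D / m * r ^ n) * (1 / (1 - r)) * m ^ n"
      using m0 by (intro mult_right_mono) auto
    moreover have "\<bar>a n - L * m ^ n\<bar> = \<bar>L - a n / m ^ n\<bar> * m ^ n"
    proof -
      have "\<bar>L - a n / m ^ n\<bar> * m ^ n = \<bar>(L - a n / m ^ n) * m ^ n\<bar>" using m0 by (simp add: abs_mult)
      also have "(L - a n / m ^ n) * m ^ n = L * m ^ n - a n" using m0 by (simp add: field_simps)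
      finally show ?thesis by (simp add: abs_minus_commute)
    qed
    moreover have "(D / m * r ^ n) * (1 / (1 - r)) * m ^ n = (D / m / (1 - r)) / 3 ^ n"
      using m0 by (simp add: r_def power_divide power_mult_distrib)
    ultimately show ?thesis by simp
  qed
  thus ?thesis by blast
qed

text \<open>When the modulus of \<open>m\<close> equals 1/3 the errors add up without damping,
  whence the factor linear in \<open>n\<close>; the slope \<open>3 * D\<close> comes from
  \<open>D / 3 ^ n = 3 * D / 3 ^ Suc n\<close>.\<close>

lemma perturbed_recurrence_decays:
  fixes a :: "nat \<Rightarrow> real"
  assumes step: "\<And>n. \<bar>a (Suc n) - m * a n\<bar> \<le> D / 3 ^ n" and m: "\<bar>m\<bar> \<le> 1 / 3"
  shows "\<bar>a n\<bar> \<le> (\<bar>a 0\<bar> + 3 * D * real n) / 3 ^ n"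
proof (induction n)
  case (Suc n)
  have "\<bar>a (Suc n)\<bar> \<le> \<bar>m\<bar> * \<bar>a n\<bar> + D / 3 ^ n"
    using step[of n] abs_mult[of m "a n"] by linarith
  also have "\<bar>m\<bar> * \<bar>a n\<bar> \<le> (1 / 3) * ((\<bar>a 0\<bar> + 3 * D * real n) / 3 ^ n)"
    by (intro mult_mono m Suc) auto
  also have "(1 / 3) * ((\<bar>a 0\<bar> + 3 * D * real n) / 3 ^ n) + D / 3 ^ n = (\<bar>a 0\<bar> + 3 * D * real (Suc n)) / 3 ^ Suc n"
    by (simp add: field_simps)
  finally show ?case by simp
qed simp

section \<open>Exponential growth rates\<close>

lemma eln_mono: "0 \<le> x \<Longrightarrow> x \<le> y \<Longrightarrow> eln x \<le> eln y"
  by (auto simp: eln_def)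

lemma growth_tendsto:
  assumes "C > 0" "\<rho> > 0"
  shows "(\<lambda>n. ereal (1 / real n) * eln (C * \<rho> ^ n)) \<longlonglongrightarrow> ereal (ln \<rho>)"
proof -
  have "(\<lambda>n. ln C / real n + ln \<rho>) \<longlonglongrightarrow> ln \<rho>" by real_asymp
  hence "(\<lambda>n. ereal (ln C / real n + ln \<rho>)) \<longlonglongrightarrow> ereal (ln \<rho>)" by simp
  moreover have "\<forall>\<^sub>F n in sequentially. ereal (1 / real n) * eln (C * \<rho> ^ n) = ereal (ln C / real n + ln \<rho>)"
    using eventually_gt_at_top[of 0]
    by eventually_elim (use assms in \<open>simp add: eln_def ln_mult ln_realpow field_simps\<close>)
  ultimately show ?thesis by (subst tendsto_cong)
qed

text \<open>The factor \<open>n + 1\<close>, which accommodates the resonant eigenvalue, disappears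
  in the exponential rate; the value \<open>eln 0 = -\<infinity>\<close> is covered by
  \<open>eln_mono\<close>.\<close>

lemma growth_le:
  assumes N: "\<And>n. 0 \<le> N n" "\<And>n. N n \<le> C * (real n + 1) * \<rho> ^ n" and "C > 0" "\<rho> > 0"
  shows "limsup (\<lambda>n. ereal (1 / real n) * eln (N n)) \<le> ereal (ln \<rho>)"
proof -
  have "(\<lambda>n. ln C / real n + ln (real n + 1) / real n + ln \<rho>) \<longlonglongrightarrow> ln \<rho>" by real_asymp
  hence lim: "(\<lambda>n. ereal (ln C / real n + ln (real n + 1) / real n + ln \<rho>)) \<longlonglongrightarrow> ereal (ln \<rho>)" by simp
  have "\<forall>\<^sub>F n in sequentially. ereal (1 / real n) * eln (N n) \<le> ereal (ln C / real n + ln (real n + 1) / real n + ln \<rho>)"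
    using eventually_gt_at_top[of 0]
  proof eventually_elim
    case (elim n)
    have "ereal (1 / real n) * eln (N n) \<le> ereal (1 / real n) * eln (C * (real n + 1) * \<rho> ^ n)"
      using N by (intro ereal_mult_left_mono eln_mono) auto
    also have "\<dots> = ereal (ln C / real n + ln (real n + 1) / real n + ln \<rho>)"
    proof -
      have "C * (real n + 1) * \<rho> ^ n > 0" using assms(3,4) by (intro mult_pos_pos) auto
      moreover have "ln (C * (real n + 1) * \<rho> ^ n) = ln C + ln (real n + 1) + real n * ln \<rho>"
        using assms(3,4) by (simp add: ln_mult ln_realpow)
      moreover have "eln X = ereal (ln X)" if "X > 0" for X using that by (simp add: eln_def)
      ultimately have "eln (C * (real n + 1) * \<rho> ^ n) = ereal (ln C + ln (real n + 1) + real n * ln \<rho>)"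
        by (simp only:)
      thus ?thesis using elim by (simp add: add_divide_distrib distrib_left)
    qed
    finally show ?case .
  qed
  hence "limsup (\<lambda>n. ereal (1 / real n) * eln (N n)) \<le> limsup (\<lambda>n. ereal (ln C / real n + ln (real n + 1) / real n + ln \<rho>))"
    by (rule Limsup_mono)
  also have "\<dots> = ereal (ln \<rho>)" by (rule lim_imp_Limsup[OF _ lim]) simp
  finally show ?thesis .
qed

text \<open>Since \<open>\<rho> > 1 / 3\<close>, the error is negligible against
  \<open>\<rho> ^ n\<close>, and eventually at least half of the main term remains.\<close>

lemma growth_ge:
  assumes N: "\<And>n. c * \<rho> ^ n - C * (real n + 1) / 3 ^ n \<le> N n" and "c > 0" "\<rho> > 1 / 3"
  shows "ereal (ln \<rho>) \<le> limsup (\<lambda>n. ereal (1 / real n) * eln (N n))"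
proof -
  define r where "r = 1 / (3 * \<rho>)"
  have r: "0 < r" "r < 1" and \<rho>: "\<rho> > 0" using assms(3) by (auto simp: r_def field_simps)
  have "(\<lambda>n. real n * r ^ n) \<longlonglongrightarrow> 0" using r by (intro powser_times_n_limit_0) (simp only: real_norm_def abs_of_pos)
  moreover have "(\<lambda>n. r ^ n) \<longlonglongrightarrow> 0" using r by (intro LIMSEQ_power_zero) (simp only: real_norm_def abs_of_pos)
  ultimately have "(\<lambda>n. C * (real n * r ^ n + r ^ n)) \<longlonglongrightarrow> C * (0 + 0)"
    by (intro tendsto_mult_left tendsto_add)
  hence "(\<lambda>n. C * (real n * r ^ n + r ^ n)) \<longlonglongrightarrow> 0" by simp
  hence ev: "\<forall>\<^sub>F n in sequentially. C * (real n * r ^ n + r ^ n) < c / 2"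
    by (rule order_tendstoD(2)) (use assms(2) in simp)
  have "\<forall>\<^sub>F n in sequentially. ereal (1 / real n) * eln (c / 2 * \<rho> ^ n) \<le> ereal (1 / real n) * eln (N n)"
    using ev
  proof eventually_elim
    case (elim n)
    have "C * (real n * r ^ n + r ^ n) * \<rho> ^ n \<le> c / 2 * \<rho> ^ n"
      using elim \<rho> by (intro mult_right_mono) auto
    moreover have "C * (real n * r ^ n + r ^ n) * \<rho> ^ n = C * (real n + 1) / 3 ^ n"
      using \<rho> by (simp add: r_def power_divide power_mult_distrib field_simps)
    ultimately have "c / 2 * \<rho> ^ n \<le> N n" using N[of n] by linarith
    thus ?case using assms(2) \<rho> by (intro ereal_mult_left_mono eln_mono) auto
  qed
  hence "limsup (\<lambda>n. ereal (1 / real n) * eln (c / 2 * \<rho> ^ n)) \<le> limsup (\<lambda>n. ereal (1 / real n) * eln (N n))"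
    by (rule Limsup_mono)
  moreover have "limsup (\<lambda>n. ereal (1 / real n) * eln (c / 2 * \<rho> ^ n)) = ereal (ln \<rho>)"
    using growth_tendsto[of "c / 2" \<rho>] assms(2) \<rho> by (intro lim_imp_Limsup) auto
  ultimately show ?thesis by simp
qed

section \<open>The six maps and their eigenvectors\<close>

text \<open>Row \<open>i\<close> lists the target quarters of the twelve branches; successive
  triples belong to successive source quarters. The order inside the triples is such that
  \<open>frame_tau\<close> holds branch by branch.\<close>

definition tau :: "nat \<Rightarrow> nat \<Rightarrow> nat" where
  "tau i j = [[1, 1, 3, 1, 3, 2, 3, 2, 0, 2, 0, 0],
              [2, 1, 1, 3, 3, 0, 0, 2, 1, 3, 0, 2],
              [0, 1, 2, 2, 3, 3, 1, 2, 3, 0, 0, 1],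
              [3, 3, 0, 3, 0, 2, 0, 2, 1, 2, 1, 1],
              [2, 3, 3, 0, 0, 1, 1, 2, 3, 0, 1, 2],
              [1, 3, 2, 2, 0, 0, 3, 2, 0, 1, 1, 3]] ! (i - 1) ! j"

text \<open>\<open>frame i\<close> is the inverse of the permutation attached to the class of \<open>i\<close>; \<open>tau i\<close> is \<open>path_map\<close>
  below, conjugated by the permutations of the source and target classes.\<close>

definition frame :: "nat \<Rightarrow> nat \<Rightarrow> nat" where
  "frame i k = [[0, 1, 2, 3], [3, 0, 2, 1], [1, 3, 2, 0]] ! ((i - 1) mod 3) ! k"

text \<open>Eigenvectors of 3 minus the path Laplacian, for the eigenvalues 3,
  \<open>1 + sqrt 2\<close>, 1, \<open>1 - sqrt 2\<close> in this order.\<close>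

definition path_eigvec :: "nat \<Rightarrow> nat \<Rightarrow> real" where
  "path_eigvec j k =
     [[1, 1, 1, 1],
      [1 + sqrt 2, 1, - 1, - 1 - sqrt 2],
      [1, - 1, - 1, 1],
      [1, - 1 - sqrt 2, 1 + sqrt 2, - 1]] ! (j - 1) ! k"

text \<open>The path eigenvector read in the frame of symbol \<open>i\<close>; vanishing from index
  4 on puts it into \<open>vecs 4\<close>.\<close>

definition eigvec :: "nat \<Rightarrow> nat \<Rightarrow> nat \<Rightarrow> real" where
  "eigvec i j k = (if k < 4 then path_eigvec j (frame i k) else 0)"

text \<open>Eigenvalues of the path matrix divided by the slope 3.\<close>

definition eigval :: "nat \<Rightarrow> real" where
  "eigval j = [1, (1 + sqrt 2) / 3, 1 / 3, (1 - sqrt 2) / 3] ! (j - 1)"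

text \<open>Squared Euclidean norms of the path eigenvectors.\<close>

definition eignorm :: "nat \<Rightarrow> real" where
  "eignorm j = [4, 8 + 4 * sqrt 2, 4, 8 + 4 * sqrt 2] ! (j - 1)"

lemma symbols: "i \<in> {1..6::nat} \<longleftrightarrow> i = 1 \<or> i = 2 \<or> i = 3 \<or> i = 4 \<or> i = 5 \<or> i = 6"
  by auto

lemma less_four: "k < (4::nat) \<longleftrightarrow> k = 0 \<or> k = 1 \<or> k = 2 \<or> k = 3"
  by auto

lemma exponents: "j \<in> {1..4::nat} \<longleftrightarrow> j = 1 \<or> j = 2 \<or> j = 3 \<or> j = 4"
  by auto

lemma sum_four: "(\<Sum>k<4. f k) = f 0 + f 1 + f 2 + f (3::nat)"
  by (simp add: lessThan_nat_numeral add_ac)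

lemma sum_twelve: "(\<Sum>k<12. f k) = f 0 + f 1 + f 2 + f 3 + f 4 + f 5 + f 6 + f 7 + f 8 + f 9 + f 10 + f (11::nat)"
  by (simp add: lessThan_nat_numeral add_ac)

lemma balanced_tau: "i \<in> {1..6} \<Longrightarrow> balanced (tau i)"
proof -
  assume "i \<in> {1..6}"
  moreover have "card {j. j < 12 \<and> tau i j = k} = (\<Sum>j<12. if tau i j = k then 1 else 0)" for k
    by (simp add: sum.If_cases Int_def)
  moreover have "j < 12 \<longleftrightarrow> j \<in> {0,1,2,3,4,5,6,7,8,9,10,11::nat}" for j by (simp only: insert_iff empty_iff) presburger
  ultimately show ?thesis
    unfolding balanced_def symbols less_four
    by (elim disjE) (simp_all add: sum_twelve tau_def nth_Cons')
qed

lemma transfer_tau: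
  fixes v :: "nat \<Rightarrow> 'a :: comm_ring_1"
  shows "transfer (tau 1) v 0 = v 2 + 2 * v 3"
    and "transfer (tau 1) v 1 = 2 * v 0 + v 1"
    and "transfer (tau 1) v 2 = v 1 + v 2 + v 3"
    and "transfer (tau 1) v 3 = v 0 + v 1 + v 2"
    and "transfer (tau 2) v 0 = v 1 + v 2 + v 3"
    and "transfer (tau 2) v 1 = 2 * v 0 + v 2"
    and "transfer (tau 2) v 2 = v 0 + v 2 + v 3"
    and "transfer (tau 2) v 3 = 2 * v 1 + v 3"
    and "transfer (tau 3) v 0 = v 0 + 2 * v 3"
    and "transfer (tau 3) v 1 = v 0 + v 2 + v 3"
    and "transfer (tau 3) v 2 = v 0 + v 1 + v 2"
    and "transfer (tau 3) v 3 = 2 * v 1 + v 2"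
    and "transfer (tau 4) v 0 = v 0 + v 1 + v 2"
    and "transfer (tau 4) v 1 = v 2 + 2 * v 3"
    and "transfer (tau 4) v 2 = v 1 + v 2 + v 3"
    and "transfer (tau 4) v 3 = 2 * v 0 + v 1"
    and "transfer (tau 5) v 0 = 2 * v 1 + v 3"
    and "transfer (tau 5) v 1 = v 1 + v 2 + v 3"
    and "transfer (tau 5) v 2 = v 0 + v 2 + v 3"
    and "transfer (tau 5) v 3 = 2 * v 0 + v 2"
    and "transfer (tau 6) v 0 = 2 * v 1 + v 2"
    and "transfer (tau 6) v 1 = v 0 + 2 * v 3"
    and "transfer (tau 6) v 2 = v 0 + v 1 + v 2"
    and "transfer (tau 6) v 3 = v 0 + v 2 + v 3"
proof -
  have expand: "transfer t v k = (\<Sum>j<12. if t j = k then v (j div 3) else 0)" for t and v :: "nat \<Rightarrow> 'a" and k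
    by (simp add: transfer_def sum.If_cases Int_def)
  show "transfer (tau 1) v 0 = v 2 + 2 * v 3" by (simp add: expand sum_twelve tau_def nth_Cons')
  show "transfer (tau 1) v 1 = 2 * v 0 + v 1" by (simp add: expand sum_twelve tau_def nth_Cons')
  show "transfer (tau 1) v 2 = v 1 + v 2 + v 3" by (simp add: expand sum_twelve tau_def nth_Cons')
  show "transfer (tau 1) v 3 = v 0 + v 1 + v 2" by (simp add: expand sum_twelve tau_def nth_Cons')
  show "transfer (tau 2) v 0 = v 1 + v 2 + v 3" by (simp add: expand sum_twelve tau_def nth_Cons')
  show "transfer (tau 2) v 1 = 2 * v 0 + v 2" by (simp add: expand sum_twelve tau_def nth_Cons')
  show "transfer (tau 2) v 2 = v 0 + v 2 + v 3" by (simp add: expand sum_twelve tau_def nth_Cons')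
  show "transfer (tau 2) v 3 = 2 * v 1 + v 3" by (simp add: expand sum_twelve tau_def nth_Cons')
  show "transfer (tau 3) v 0 = v 0 + 2 * v 3" by (simp add: expand sum_twelve tau_def nth_Cons')
  show "transfer (tau 3) v 1 = v 0 + v 2 + v 3" by (simp add: expand sum_twelve tau_def nth_Cons')
  show "transfer (tau 3) v 2 = v 0 + v 1 + v 2" by (simp add: expand sum_twelve tau_def nth_Cons')
  show "transfer (tau 3) v 3 = 2 * v 1 + v 2" by (simp add: expand sum_twelve tau_def nth_Cons')
  show "transfer (tau 4) v 0 = v 0 + v 1 + v 2" by (simp add: expand sum_twelve tau_def nth_Cons')
  show "transfer (tau 4) v 1 = v 2 + 2 * v 3" by (simp add: expand sum_twelve tau_def nth_Cons')
  show "transfer (tau 4) v 2 = v 1 + v 2 + v 3" by (simp add: expand sum_twelve tau_def nth_Cons')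
  show "transfer (tau 4) v 3 = 2 * v 0 + v 1" by (simp add: expand sum_twelve tau_def nth_Cons')
  show "transfer (tau 5) v 0 = 2 * v 1 + v 3" by (simp add: expand sum_twelve tau_def nth_Cons')
  show "transfer (tau 5) v 1 = v 1 + v 2 + v 3" by (simp add: expand sum_twelve tau_def nth_Cons')
  show "transfer (tau 5) v 2 = v 0 + v 2 + v 3" by (simp add: expand sum_twelve tau_def nth_Cons')
  show "transfer (tau 5) v 3 = 2 * v 0 + v 2" by (simp add: expand sum_twelve tau_def nth_Cons')
  show "transfer (tau 6) v 0 = 2 * v 1 + v 2" by (simp add: expand sum_twelve tau_def nth_Cons')
  show "transfer (tau 6) v 1 = v 0 + 2 * v 3" by (simp add: expand sum_twelve tau_def nth_Cons')
  show "transfer (tau 6) v 2 = v 0 + v 1 + v 2" by (simp add: expand sum_twelve tau_def nth_Cons')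
  show "transfer (tau 6) v 3 = v 0 + v 2 + v 3" by (simp add: expand sum_twelve tau_def nth_Cons')
qed

section \<open>Conjugation to the path\<close>

text \<open>In this list the two successors of a symbol are congruent modulo 3, so they carry the
  same frame.\<close>

lemma Emat_cases:
  assumes "i \<in> {1..6}" "i' \<in> {1..6}" "Emat i i' = 1"
  shows "(i, i') \<in> {(1,2),(1,5),(2,3),(2,6),(3,1),(3,4),(4,3),(4,6),(5,1),(5,4),(6,2),(6,5)}"
  using assms unfolding symbols by (elim disjE) (simp_all add: Emat_def nth_Cons')

text \<open>The neighbours of 0, 1, 2, 3 on the path as four triples: each vertex has a loop, and
  the two ends have a second one.\<close>

definition path_map :: "nat \<Rightarrow> nat" where
  "path_map j = [0, 0, 1, 0, 1, 2, 1, 2, 3, 2, 3, 3] ! j"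

text \<open>The conjugation on which the construction rests: in the frame of \<open>i\<close> at the
  source and of a successor at the target, the maps of all symbols coincide with one path. It is a
  finite check over the twelve transitions.\<close>

lemma frame_tau:
  assumes i: "i \<in> {1..6}" "i' \<in> {1..6}" "Emat i i' = 1"
  shows "\<forall>k<4. \<forall>r<3. frame i' (tau i (3 * k + r)) = path_map (3 * frame i k + r)"
proof -
  have "r < 3 \<longleftrightarrow> r = 0 \<or> r = 1 \<or> r = 2" for r :: nat by auto
  thus ?thesis
    using Emat_cases[OF i] unfolding less_four
    by (simp only: insert_iff empty_iff Pair_inject simp_thms, elim disjE conjE)
       (simp_all add: frame_def tau_def path_map_def nth_Cons' all_conj_distrib)
qed

lemma sum_frame:
  fixes f :: "nat \<Rightarrow> 'a :: comm_monoid_add"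
  assumes "i \<in> {1..6}"
  shows "(\<Sum>k<4. f (frame i k)) = (\<Sum>k<4. f k)"
  using assms unfolding symbols sum_four
  by (elim disjE) (simp_all add: frame_def add_ac)

lemma frame_less: "i \<in> {1..6} \<Longrightarrow> k < 4 \<Longrightarrow> frame i k < 4"
  unfolding symbols less_four by (elim disjE) (simp_all add: frame_def)

text \<open>The eigenvector equation of the path matrix; the factor 3 undoes the normalization in
  \<open>eigval\<close>.\<close>

lemma path_eigvec_eq:
  assumes "j \<in> {1..4}" "m < 4"
  shows "(\<Sum>r<3. path_eigvec j (path_map (3 * m + r))) = 3 * eigval j * path_eigvec j m"
proof -
  have "(\<Sum>r<3. f r) = f 0 + f 1 + f (2::nat)" for f :: "nat \<Rightarrow> real"
    by (simp add: lessThan_nat_numeral add_ac)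
  thus ?thesis
    using assms unfolding exponents less_four
    by (elim disjE) (simp_all add: path_eigvec_def path_map_def eigval_def algebra_simps)
qed

lemma path_eigvec_orthogonal:
  assumes "j \<in> {1..4}" "l \<in> {1..4}"
  shows "(\<Sum>k<4. path_eigvec j k * path_eigvec l k) = (if j = l then eignorm j else 0)"
  using assms unfolding exponents sum_four
  by (elim disjE) (simp_all add: path_eigvec_def eignorm_def algebra_simps)

text \<open>Resolution of the identity for the orthogonal basis of eigenvectors.\<close>

lemma path_eigvec_complete:
  assumes "k < 4" "l < 4"
  shows "(\<Sum>j\<in>{1..4}. path_eigvec j k * path_eigvec j l / eignorm j) = (if k = l then 1 else 0)"
proof -
  have s: "{1..4} = {1,2,3,4::nat}" by auto
  have "8 + 4 * sqrt 2 \<noteq> 0" by (smt (verit) real_sqrt_ge_zero)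
  \<comment> \<open>The denominator is rationalized by
    \<open>(8 + 4 * sqrt 2) * (2 - sqrt 2) = 8\<close>; the second form covers the other order of
    the factors.\<close>
  hence n: "x / (8 + 4 * sqrt 2) = x * (2 - sqrt 2) / 8" "x / (8 + sqrt 2 * 4) = x * (2 - sqrt 2) / 8" for x
    by (simp_all add: divide_simps) (simp_all add: algebra_simps)
  show ?thesis
    using assms unfolding less_four s
    by (elim disjE) (simp_all add: path_eigvec_def eignorm_def n algebra_simps add_divide_distrib diff_divide_distrib)
qed

lemma frame_inject: "i \<in> {1..6} \<Longrightarrow> k < 4 \<Longrightarrow> l < 4 \<Longrightarrow> frame i k = frame i l \<longleftrightarrow> k = l"
  unfolding symbols less_four by (elim disjE) (simp_all add: frame_def)

lemma tau_less: "i \<in> {1..6} \<Longrightarrow> j < 12 \<Longrightarrow> tau i j < 4"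
  using balanced_tau by (auto simp: balanced_def)

section \<open>Spectral coordinates in moving frames\<close>

text \<open>Unnormalized inner product with an eigenvector; dividing by \<open>eignorm j\<close>
  gives the expansion coefficient.\<close>

definition coord :: "nat \<Rightarrow> nat \<Rightarrow> (nat \<Rightarrow> real) \<Rightarrow> real" where
  "coord i j v = (\<Sum>k<4. eigvec i j k * v k)"

lemma sum_twelve_split:
  fixes f :: "nat \<Rightarrow> 'a :: comm_monoid_add"
  shows "(\<Sum>l<12. f l) = (\<Sum>m<4. \<Sum>r<3. f (3 * m + r))"
proof -
  have "(\<Sum>r<3. g r) = g 0 + g 1 + g (2::nat)" for g :: "nat \<Rightarrow> 'a"
    by (simp add: lessThan_nat_numeral add_ac)
  thus ?thesis by (simp add: sum_twelve sum_four add_ac flip: numeral_2_eq_2)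
qed

text \<open>The transition matrix of the path is symmetric, so its eigenvectors also give the
  dual coordinates.\<close>

lemma coord_transfer:
  assumes i: "i \<in> {1..6}" "i' \<in> {1..6}" "Emat i i' = 1" and j: "j \<in> {1..4}"
  shows "coord i' j (\<lambda>k. transfer (tau i) v k / 3) = eigval j * coord i j v"
proof -
  have "coord i' j (\<lambda>k. transfer (tau i) v k / 3)
      = (\<Sum>k<4. \<Sum>l | l < 12 \<and> tau i l = k. eigvec i' j (tau i l) * v (l div 3)) / 3"
    by (auto simp: coord_def transfer_def sum_distrib_left simp flip: sum_divide_distrib intro!: sum.cong)
  \<comment> \<open>Every twelfth has exactly one target, so the double sum over targets and fibres
    runs once through all twelfths.\<close>
  also have "\<dots> = (\<Sum>l<12. eigvec i' j (tau i l) * v (l div 3)) / 3"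
    by (simp only: sum_fibres_all[OF balanced_tau[OF i(1)]])
  also have "\<dots> = (\<Sum>m<4. \<Sum>r<3. eigvec i' j (tau i (3 * m + r)) * v ((3 * m + r) div 3)) / 3"
    by (simp only: sum_twelve_split)
  \<comment> \<open>\<open>frame_tau\<close> turns the targets into neighbours on the path, where
    the eigenvector equation applies.\<close>
  also have "\<dots> = (\<Sum>m<4. (\<Sum>r<3. path_eigvec j (path_map (3 * frame i m + r))) * v m) / 3"
    using frame_tau[OF i] tau_less[OF i(1)]
    by (auto simp: eigvec_def sum_distrib_right intro!: sum.cong arg_cong2[where f="(/)"])
  also have "\<dots> = (\<Sum>m<4. eigval j * (eigvec i j m * v m))"
    using frame_less[OF i(1)]
    by (auto simp: path_eigvec_eq[OF j] eigvec_def sum_divide_distrib intro!: sum.cong)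
  finally show ?thesis by (simp add: coord_def sum_distrib_left)
qed

lemma coord_eigvec:
  assumes i: "i \<in> {1..6}" and j: "j \<in> {1..4}" and l: "l \<in> {1..4}"
  shows "coord i j (eigvec i l) = (if j = l then eignorm j else 0)"
proof -
  have "coord i j (eigvec i l) = (\<Sum>k<4. path_eigvec j (frame i k) * path_eigvec l (frame i k))"
    by (simp add: coord_def eigvec_def)
  also have "\<dots> = (\<Sum>k<4. path_eigvec j k * path_eigvec l k)"
    by (rule sum_frame[OF i])
  finally show ?thesis using path_eigvec_orthogonal[OF j l] by simp
qed

text \<open>Completeness of the path eigenvectors, transported by the permutation
  \<open>frame i\<close>.\<close>

lemma coord_expansion:
  assumes i: "i \<in> {1..6}" and k: "k < 4"
  shows "v k = (\<Sum>j\<in>{1..4}. coord i j v / eignorm j * eigvec i j k)"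
proof -
  have "(\<Sum>j\<in>{1..4}. coord i j v / eignorm j * eigvec i j k)
      = (\<Sum>j\<in>{1..4}. \<Sum>l<4. v l * (path_eigvec j (frame i k) * path_eigvec j (frame i l) / eignorm j))"
    using k unfolding coord_def eigvec_def sum_divide_distrib sum_distrib_right
    by (intro sum.cong refl) simp
  also have "\<dots> = (\<Sum>l<4. v l * (\<Sum>j\<in>{1..4}. path_eigvec j (frame i k) * path_eigvec j (frame i l) / eignorm j))"
    by (subst sum.swap) (simp only: sum_distrib_left)
  also have "\<dots> = (\<Sum>l<4. v l * (if k = l then 1 else 0))"
    using frame_less[OF i] k
    by (intro sum.cong refl arg_cong2[where f="(*)"])
       (simp only: path_eigvec_complete frame_inject[OF i] lessThan_iff)
  also have "\<dots> = v k" using k by (simp add: if_distrib[of "(*) _"] sum.delta cong: if_cong)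
  finally show ?thesis ..
qed

lemma eignorm_ge: "j \<in> {1..4} \<Longrightarrow> 4 \<le> eignorm j"
  unfolding exponents by (elim disjE) (simp_all add: eignorm_def)

lemma sqrt2_bounds: "1.4 < sqrt 2" "sqrt 2 < 1.5"
proof -
  show "1.4 < sqrt 2" by (rule real_less_rsqrt) (simp add: power2_eq_square)
  show "sqrt 2 < 1.5" by (rule real_less_lsqrt) (simp_all add: power2_eq_square)
qed

lemma abs_eigvec_le: "j \<in> {1..4} \<Longrightarrow> i \<in> {1..6} \<Longrightarrow> \<bar>eigvec i j k\<bar> \<le> 3"
proof -
  have "\<bar>path_eigvec j m\<bar> \<le> 3" if "j \<in> {1..4}" "m < 4" for m
    using that sqrt2_bounds unfolding exponents less_four
    by (elim disjE) (simp_all add: path_eigvec_def)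
  thus "j \<in> {1..4} \<Longrightarrow> i \<in> {1..6} \<Longrightarrow> \<bar>eigvec i j k\<bar> \<le> 3"
    using frame_less by (simp add: eigvec_def)
qed

text \<open>The image is expanded in the eigenbasis of the successor frame;
  \<open>coord_transfer\<close> and orthogonality leave a single coordinate.\<close>

lemma transfer_eigvec:
  assumes i: "i \<in> {1..6}" "i' \<in> {1..6}" "Emat i i' = 1" and j: "j \<in> {1..4}" and k: "k < 4"
  shows "transfer (tau i) (eigvec i j) k / 3 = eigval j * eigvec i' j k"
proof -
  have "transfer (tau i) (eigvec i j) k / 3
      = (\<Sum>l\<in>{1..4}. coord i' l (\<lambda>k. transfer (tau i) (eigvec i j) k / 3) / eignorm l * eigvec i' l k)"
    by (rule coord_expansion[OF i(2) k])
  also have "\<dots> = (\<Sum>l\<in>{1..4}. if l = j then eigval j * eigvec i' j k else 0)"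
    using eignorm_ge j
    by (intro sum.cong refl) (auto simp only: coord_transfer[OF i] coord_eigvec[OF i(1)], force+)
  finally show ?thesis using j by simp
qed

section \<open>Eigenvalues of the single maps\<close>

text \<open>The fourth power is the identity plus 20 times the all-ones matrix, in accordance with
  \<open>1 + 4 * 20 = 3 ^ 4\<close> on constants.\<close>

lemma transfer_pow4:
  fixes v :: "nat \<Rightarrow> 'a :: comm_ring_1"
  assumes "i \<in> {1..6}" "k < 4"
  shows "transfer (tau i) (transfer (tau i) (transfer (tau i) (transfer (tau i) v))) k
    = v k + 20 * (v 0 + v 1 + v 2 + v 3)"
  using assms unfolding symbols less_four
  by (elim disjE) (simp_all only: transfer_tau, simp_all add: algebra_simps)

lemma transfer_sum:
  fixes v :: "nat \<Rightarrow> 'a :: comm_ring_1"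
  assumes "i \<in> {1..6}"
  shows "(\<Sum>k<4. transfer (tau i) v k) = 3 * (\<Sum>k<4. v k)"
  using assms unfolding symbols sum_four
  by (elim disjE) (simp_all only: transfer_tau, simp_all add: algebra_simps)

lemma transfer_cong: "(\<And>k. k < 4 \<Longrightarrow> v k = w k) \<Longrightarrow> transfer t v k = transfer t w k"
  by (auto simp: transfer_def intro!: sum.cong)

lemma transfer_mult: "transfer t (\<lambda>k. c * v k) k = c * (transfer t v k :: 'a :: comm_ring_1)"
  by (simp add: transfer_def sum_distrib_left)

text \<open>On zero-sum vectors the fourth power of the transition matrix of each single map is the
  identity, so all its eigenvalues there are roots of unity.\<close>

lemma no_exceptional_eigenvalue:
  assumes i: "i \<in> {1..6}"
  shows "\<not> exceptional_eigenvalue (smap (tau i)) (chiB 4 quarter) lam"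
proof
  let ?t = "tau i"
  have t: "balanced ?t" using i by (rule balanced_tau)
  assume "exceptional_eigenvalue (smap ?t) (chiB 4 quarter) lam"
  then obtain f g where lam: "lam \<noteq> 1" "cmod lam > 1 / 3"
    and f: "f \<in> chiB 4 quarter" and g: "g \<in> chiB 4 quarter"
    and nz: "\<not> (AE x in leb1. f x = 0 \<and> g x = 0)"
    and Pf: "AE x in leb1. PF (smap ?t) f x = Re lam * f x - Im lam * g x"
    and Pg: "AE x in leb1. PF (smap ?t) g x = Im lam * f x + Re lam * g x"
    unfolding exceptional_eigenvalue_def theta_map_smap[OF t] by blast
  \<comment> \<open>Membership in \<open>chiB\<close> gives one null set per quarter; these finitely
    many null sets are merged.\<close>
  have AE_quarters: "AE x in leb1. \<forall>k<4. x \<in> quarter k \<longrightarrow> h x = c k"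
    if "\<forall>k<4. AE x in leb1. x \<in> quarter k \<longrightarrow> h x = c k" for h c :: "_ \<Rightarrow> real"
    using that by (simp add: AE_all_countable)
  have vlift_ae: "AE x in leb1. h x = vlift 4 quarter c x"
    if "\<forall>k<4. AE x in leb1. x \<in> quarter k \<longrightarrow> h x = c k" for h c :: "_ \<Rightarrow> real"
    using AE_quarters[OF that] AE_space
  proof eventually_elim
    case (elim x)
    hence "0 \<le> x" "x < 1" by simp_all
    then obtain k u where ku: "k < 4" "0 \<le> u" "u < 1" "x = (real k + u) / 4"
      by (rule quarter_ex)
    hence "h x = c k" using elim in_quarter_iff by blast
    thus ?case unfolding ku(4) vlift_quarter[OF ku(1-3)] .
  qed
  obtain v where v: "AE x in leb1. f x = vlift 4 quarter v x"
    using f vlift_ae unfolding chiB_def by (auto simp: choice_iff' choice_iff)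
  obtain w where w: "AE x in leb1. g x = vlift 4 quarter w x"
    using g vlift_ae unfolding chiB_def by (auto simp: choice_iff' choice_iff)
  have PFv: "PF (smap ?t) (vlift 4 quarter v) x = transfer ?t v k / 3" if k: "k < 4" and x: "x \<in> quarter k" for v x k
  proof -
    obtain u where u: "0 \<le> u" "u < 1" "x = (real k + u) / 4" using x unfolding in_quarter_iff by blast
    show ?thesis unfolding u(3)
      by (rule PF_step[OF t k u(1,2)]) (auto simp only: in_quarter_iff vlift_quarter)
  qed
  have vl: "vlift 4 quarter v x = v k" if "k < 4" "x \<in> quarter k" for v x k
    using that by (auto simp only: in_quarter_iff vlift_quarter)
  \<comment> \<open>Combining real and imaginary parts turns the coupled real system into one
    complex eigenvalue equation.\<close>
  define z where "z k = Complex (v k) (w k)" for k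
  have ae: "AE x in leb1. PF (smap ?t) (vlift 4 quarter v) x = Re lam * vlift 4 quarter v x - Im lam * vlift 4 quarter w x \<and>
      PF (smap ?t) (vlift 4 quarter w) x = Im lam * vlift 4 quarter v x + Re lam * vlift 4 quarter w x"
    using Pf Pg v w PF_smap_cong_AE[OF t v] PF_smap_cong_AE[OF t w] by eventually_elim simp
  have eig: "transfer ?t z k = 3 * lam * z k" if k: "k < 4" for k
  proof -
    obtain x where "x \<in> quarter k"
      "PF (smap ?t) (vlift 4 quarter v) x = Re lam * vlift 4 quarter v x - Im lam * vlift 4 quarter w x"
      "PF (smap ?t) (vlift 4 quarter w) x = Im lam * vlift 4 quarter v x + Re lam * vlift 4 quarter w x"
      using AE_leb1_quarter_ex[OF ae k] by blast
    hence "transfer ?t v k = 3 * (Re lam * v k - Im lam * w k)" "transfer ?t w k = 3 * (Im lam * v k + Re lam * w k)"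
      using PFv[OF k] vl[OF k] by simp_all
    moreover have "transfer ?t z k = Complex (transfer ?t v k) (transfer ?t w k)"
      unfolding z_def transfer_def by (simp add: complex_eq_iff)
    ultimately show ?thesis by (simp add: z_def complex_eq_iff algebra_simps)
  qed
  have "(\<Sum>k<4. transfer ?t z k) = (\<Sum>k<4. 3 * lam * z k)"
    by (intro sum.cong refl eig) simp
  \<comment> \<open>Column sums equal to 3 leave only \<open>lam = 1\<close> or a zero-sum
    vector.\<close>
  hence "3 * (\<Sum>k<4. z k) = 3 * lam * (\<Sum>k<4. z k)"
    by (simp only: transfer_sum[OF i] sum_distrib_left)
  hence "(lam - 1) * (\<Sum>k<4. z k) = 0" by (simp add: algebra_simps)
  hence sum0: "z 0 + z 1 + z 2 + z 3 = 0" using lam(1) by (simp add: sum_four)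
  have pow: "(transfer ?t ^^ n) z k = (3 * lam) ^ n * z k" if "k < 4" for n k
    using that
  proof (induction n arbitrary: k)
    case (Suc n)
    have "(transfer ?t ^^ Suc n) z k = transfer ?t (\<lambda>k. (3 * lam) ^ n * z k) k"
      using transfer_cong[OF Suc.IH] by simp
    thus ?case by (simp add: transfer_mult eig[OF Suc.prems])
  qed simp
  have "(3 * lam) ^ 4 * z k = z k" if "k < 4" for k
  proof -
    have "(transfer ?t ^^ 4) z k = z k"
      using transfer_pow4[OF i that, of z] unfolding sum0 by (simp add: numeral_eq_Suc)
    thus ?thesis using pow[OF that, of 4] by simp
  qed
  \<comment> \<open>\<open>cmod lam > 1 / 3\<close> places \<open>3 * lam\<close> outside the closed
    unit disc.\<close>
  moreover have "(3 * lam) ^ 4 \<noteq> 1"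
  proof
    assume "(3 * lam) ^ 4 = 1"
    hence "cmod ((3 * lam) ^ 4) = 1" by simp
    hence "cmod (3 * lam) ^ 4 = 1" by (simp only: norm_power)
    moreover have "cmod (3 * lam) ^ 4 > 1"
      using lam(2) by (intro one_less_power) (auto simp: norm_mult)
    ultimately show False by simp
  qed
  ultimately have "z k = 0" if "k < 4" for k using that by (metis mult_cancel_right1)
  hence z0: "v k = 0 \<and> w k = 0" if "k < 4" for k using that by (simp add: z_def complex_eq_iff)
  have "AE x in leb1. f x = 0 \<and> g x = 0"
    using v w by eventually_elim (use z0 in \<open>simp add: vlift_def\<close>)
  thus False using nz by blast
qed

lemma Theta_symbol: "\<omega> \<in> Theta \<Longrightarrow> \<omega> k \<in> {1..6}"
  by (simp add: Theta_def)

lemma Theta_edge: "\<omega> \<in> Theta \<Longrightarrow> Emat (\<omega> k) (\<omega> (k + 1)) = 1"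
  by (simp add: Theta_def)

lemma Theta_edge_nat: "\<omega> \<in> Theta \<Longrightarrow> Emat (\<omega> (int n)) (\<omega> (int (Suc n))) = 1"
  using Theta_edge[of \<omega> "int n"] by (simp add: add.commute)

abbreviation (input) "mu \<equiv> (1 + sqrt 2) / 3"

lemma mu_bounds: "1 / 3 < mu" "mu < 1"
  using sqrt2_bounds by simp_all

lemma abs_eigval_4: "\<bar>(1 - sqrt 2) / 3\<bar> \<le> 1 / 3"
  using sqrt2_bounds by simp

section \<open>Trichotomy of growth rates\<close>

text \<open>\<open>a1\<close> to \<open>a4\<close> stand for the eigencoordinates and
  \<open>N\<close> for the norm of the iterates. If the limit of \<open>a1\<close> is nonzero, the
  rate is nonnegative; otherwise the rescaled limit of \<open>a2\<close> decides between exactly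
  \<open>ln m\<close> and at most \<open>ln (1 / 3)\<close>.\<close>

lemma growth_trichotomy:
  fixes a1 a2 a3 a4 N :: "nat \<Rightarrow> real"
  assumes step1: "\<And>n. \<bar>a1 (Suc n) - 1 * a1 n\<bar> \<le> D / 3 ^ n"
    and step2: "\<And>n. \<bar>a2 (Suc n) - m * a2 n\<bar> \<le> D / 3 ^ n"
    and step3: "\<And>n. \<bar>a3 (Suc n) - m3 * a3 n\<bar> \<le> D / 3 ^ n"
    and step4: "\<And>n. \<bar>a4 (Suc n) - m4 * a4 n\<bar> \<le> D / 3 ^ n"
    and m: "1 / 3 < m" "\<bar>m3\<bar> \<le> 1 / 3" "\<bar>m4\<bar> \<le> 1 / 3"
    and N0: "\<And>n. 0 \<le> N n"
    and up: "\<And>n. N n \<le> 8 * (\<bar>a1 n\<bar> + \<bar>a2 n\<bar> + \<bar>a3 n\<bar> + \<bar>a4 n\<bar>) + D / 3 ^ n"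
    and low1: "\<And>n. \<bar>a1 n\<bar> \<le> 48 * N n + D / 3 ^ n"
    and low2: "\<And>n. \<bar>a2 n\<bar> \<le> 48 * N n + D / 3 ^ n"
  defines "l \<equiv> limsup (\<lambda>n. ereal (1 / real n) * eln (N n))"
  shows "0 \<le> l \<or> l = ereal (ln m) \<or> l \<le> ereal (ln (1 / 3))"
proof -
  have D: "0 \<le> D" using step1[of 0] by simp
  obtain L1 C1 where L1: "\<And>n. \<bar>a1 n - L1 * 1 ^ n\<bar> \<le> C1 / 3 ^ n"
    using perturbed_recurrence_converges[OF step1] by auto
  obtain L2 C2 where L2: "\<And>n. \<bar>a2 n - L2 * m ^ n\<bar> \<le> C2 / 3 ^ n"
    using perturbed_recurrence_converges[OF step2 m(1)] by auto
  have C1: "0 \<le> C1" using L1[of 0] by simp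
  have C2: "0 \<le> C2" using L2[of 0] by simp
  have m0: "m > 0" using m(1) by simp
  have scale: "x / 3 ^ n \<le> x * (real n + 1) / 3 ^ n" if "0 \<le> x" for x n
    using that by (intro divide_right_mono) (auto simp: algebra_simps)
  \<comment> \<open>A coordinate bounded by the norm transfers its leading term to a lower bound for
    the norm; this serves \<open>a1\<close> and \<open>a2\<close> alike.\<close>
  have lower: "\<bar>L\<bar> / 48 * \<rho> ^ n - ((C + D) / 48) * (real n + 1) / 3 ^ n \<le> N n"
    if "\<bar>a n - L * \<rho> ^ n\<bar> \<le> C / 3 ^ n" "\<bar>a n\<bar> \<le> 48 * N n + D / 3 ^ n" "0 \<le> C" "0 < \<rho>" for a L \<rho> C n
  proof -
    have "\<bar>L\<bar> * \<rho> ^ n = \<bar>L * \<rho> ^ n\<bar>" using that(4) by (simp add: abs_mult)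
    also have "\<dots> \<le> 48 * N n + (C + D) / 3 ^ n"
      using that(1,2) by (simp add: add_divide_distrib)
    also have "(C + D) / 3 ^ n \<le> (C + D) * (real n + 1) / 3 ^ n"
      using that(3) D by (intro scale) simp
    finally show ?thesis by (simp add: field_simps)
  qed
  show ?thesis
  proof (cases "L1 = 0")
    case False
    have "ereal (ln 1) \<le> l"
      unfolding l_def
      by (rule growth_ge[of "\<bar>L1\<bar> / 48" _ "(C1 + D) / 48"], rule lower[OF L1 low1 C1])
         (use False in auto)
    thus ?thesis by (simp add: zero_ereal_def)
  next
    case True
    define A3 where "A3 = \<bar>a3 0\<bar> + 3 * D"
    define A4 where "A4 = \<bar>a4 0\<bar> + 3 * D"
    \<comment> \<open>\<open>K\<close> collects every contribution of order
      \<open>(n + 1) / 3 ^ n\<close> once the limit of \<open>a1\<close> is zero; only the leading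
      term of \<open>a2\<close> stays apart.\<close>
    define K where "K = 8 * (C1 + C2 + A3 + A4) + D"
    have K: "0 \<le> K" using C1 C2 D by (simp add: K_def A3_def A4_def)
    have dec: "\<bar>a n\<bar> \<le> (\<bar>a 0\<bar> + 3 * D) * (real n + 1) / 3 ^ n"
      if "\<bar>a n\<bar> \<le> (\<bar>a 0\<bar> + 3 * D * real n) / 3 ^ n" for a n
    proof -
      have "\<bar>a 0\<bar> + 3 * D * real n \<le> (\<bar>a 0\<bar> + 3 * D) * (real n + 1)"
        using D by (simp add: algebra_simps)
      hence "(\<bar>a 0\<bar> + 3 * D * real n) / 3 ^ n \<le> (\<bar>a 0\<bar> + 3 * D) * (real n + 1) / 3 ^ n"
        by (intro divide_right_mono) auto
      thus ?thesis using that by linarith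
    qed
    have upper: "N n \<le> 8 * \<bar>L2\<bar> * m ^ n + K * (real n + 1) / 3 ^ n" for n
    proof -
      have 1: "\<bar>a1 n\<bar> \<le> C1 * (real n + 1) / 3 ^ n"
        using L1[of n] scale[OF C1, of n] True by simp
      have "\<bar>a2 n\<bar> \<le> \<bar>L2 * m ^ n\<bar> + C2 / 3 ^ n" using L2[of n] by linarith
      hence 2: "\<bar>a2 n\<bar> \<le> \<bar>L2\<bar> * m ^ n + C2 * (real n + 1) / 3 ^ n"
        using scale[OF C2, of n] m0 by (simp add: abs_mult)
      have 3: "\<bar>a3 n\<bar> \<le> A3 * (real n + 1) / 3 ^ n"
        unfolding A3_def by (rule dec[of a3, OF perturbed_recurrence_decays[OF step3 m(2)]])
      have 4: "\<bar>a4 n\<bar> \<le> A4 * (real n + 1) / 3 ^ n"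
        unfolding A4_def by (rule dec[of a4, OF perturbed_recurrence_decays[OF step4 m(3)]])
      have 5: "D / 3 ^ n \<le> D * (real n + 1) / 3 ^ n" using scale[OF D] .
      have "N n \<le> 8 * (C1 * (real n + 1) / 3 ^ n + (\<bar>L2\<bar> * m ^ n + C2 * (real n + 1) / 3 ^ n)
          + A3 * (real n + 1) / 3 ^ n + A4 * (real n + 1) / 3 ^ n) + D * (real n + 1) / 3 ^ n"
        by (rule order_trans[OF up]) (intro add_mono mult_left_mono 1 2 3 4 5, simp)
      also have "\<dots> = 8 * \<bar>L2\<bar> * m ^ n + K * (real n + 1) / 3 ^ n"
        unfolding K_def by (simp add: field_simps)
      finally show ?thesis .
    qed
    show ?thesis
    proof (cases "L2 = 0")
      case True
      have "l \<le> ereal (ln (1 / 3))"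
        unfolding l_def
      proof (rule growth_le[OF N0])
        fix n
        have "K * (real n + 1) / 3 ^ n \<le> (K + 1) * (real n + 1) / 3 ^ n"
          by (intro divide_right_mono mult_right_mono) auto
        thus "N n \<le> (K + 1) * (real n + 1) * (1 / 3) ^ n"
          using upper[of n] True by (simp add: power_divide)
      qed (use K in auto)
      thus ?thesis by blast
    next
      case False
      have "l \<le> ereal (ln m)"
        unfolding l_def
      proof (rule growth_le[OF N0])
        fix n
        have "(1 / 3) ^ n \<le> m ^ n" using m(1) by (intro power_mono) auto
        hence "K * (real n + 1) * (1 / 3) ^ n \<le> K * (real n + 1) * m ^ n"
          using K by (intro mult_left_mono) auto
        hence "K * (real n + 1) / 3 ^ n \<le> K * (real n + 1) * m ^ n"
          by (simp add: power_divide)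
        moreover have "8 * \<bar>L2\<bar> * m ^ n \<le> 8 * \<bar>L2\<bar> * (real n + 1) * m ^ n"
          using m0 by (intro mult_right_mono) (auto simp: algebra_simps)
        ultimately show "N n \<le> (8 * \<bar>L2\<bar> + K) * (real n + 1) * m ^ n"
          using upper[of n] by (simp add: algebra_simps)
      qed (use K False m0 in auto)
      moreover have "ereal (ln m) \<le> l"
        unfolding l_def
        by (rule growth_ge[of "\<bar>L2\<bar> / 48" _ "(C2 + D) / 48"], rule lower[OF L2 low2 C2])
           (use False m m0 in auto)
      ultimately show ?thesis by auto
    qed
  qed
qed

section \<open>Exponents and the Oseledets splitting\<close>

lemma Theta_cocycle: "\<omega> \<in> Theta \<Longrightarrow> smap_cocycle tau \<omega>"
  by unfold_locales (rule balanced_tau[OF Theta_symbol])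

abbreviation "family \<equiv> \<lambda>i. smap (tau i)"

lemma coord_diff: "coord i j (\<lambda>k. v k - w k) = coord i j v - coord i j w"
  by (simp add: coord_def right_diff_distrib sum_subtractf)

text \<open>Four summands with eigenvector entries of modulus at most 3 give the factor 12.\<close>

lemma coord_le:
  assumes "j \<in> {1..4}" "i \<in> {1..6}" "\<And>k. k < 4 \<Longrightarrow> \<bar>v k\<bar> \<le> K"
  shows "\<bar>coord i j v\<bar> \<le> 12 * K"
proof -
  have "\<bar>coord i j v\<bar> \<le> (\<Sum>k<4::nat. 3 * K)"
    unfolding coord_def using assms abs_eigvec_le[OF assms(1,2)]
    by (intro order_trans[OF sum_abs] sum_mono) (auto simp: abs_mult intro!: mult_mono)
  thus ?thesis by simp
qed

lemma eigval_simps: "eigval 1 = 1" "eigval 2 = mu" "eigval 3 = 1 / 3" "eigval 4 = (1 - sqrt 2) / 3"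
  by (simp_all add: eigval_def)

context
  fixes \<omega> assumes \<omega>: "\<omega> \<in> Theta"
begin

interpretation smap_cocycle tau \<omega>
  using \<omega> by (rule Theta_cocycle)

text \<open>The error of \<open>nodes_step\<close> is measured in the frame of the next symbol,
  where the exact part is diagonal by \<open>coord_transfer\<close>.\<close>

lemma coord_nodes_step:
  assumes d: "dominates q g" and j: "j \<in> {1..4}"
  shows "\<bar>coord (\<omega> (int (Suc n))) j (nodes g (Suc n)) - eigval j * coord (\<omega> (int n)) j (nodes g n)\<bar>
    \<le> 12 * spread q / 3 ^ n"
proof -
  have "\<bar>coord (\<omega> (int (Suc n))) j (\<lambda>k. nodes g (Suc n) k - transfer (tau (\<omega> (int n))) (nodes g n) k / 3)\<bar>
      \<le> 12 * (spread q / 3 ^ n)"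
    using nodes_step[OF d] by (intro coord_le[OF j Theta_symbol[OF \<omega>]])
  thus ?thesis
    unfolding coord_diff coord_transfer[OF Theta_symbol[OF \<omega>] Theta_symbol[OF \<omega>] Theta_edge_nat[OF \<omega>] j]
    by simp
qed

text \<open>The factor 48 is 12 from \<open>coord_le\<close> times 4, the inverse measure of a
  quarter.\<close>

lemma coord_le_bv_norm:
  assumes "f \<in> borel_measurable leb1" "AE x in leb1. f x = g x" "dominates q g" and j: "j \<in> {1..4}"
  shows "\<bar>coord (\<omega> (int n)) j (nodes g n)\<bar> \<le> 48 * bv_norm (pcoc family \<omega> n f) + 12 * spread q / 3 ^ n"
  using coord_le[OF j Theta_symbol[OF \<omega>] bv_norm_pcoc_ge[OF assms(1-3)]] by (simp add: algebra_simps)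

text \<open>Eigenvector entries are at most 3 in modulus while \<open>eignorm j\<close> is at least
  4, so each coordinate enters a node value with a coefficient of modulus below 1.\<close>

lemma bv_norm_le_coord:
  assumes fg: "AE x in leb1. f x = g x" and d: "dominates q g"
  defines "a j n \<equiv> coord (\<omega> (int n)) j (nodes g n)"
  shows "bv_norm (pcoc family \<omega> n f) \<le> 8 * (\<bar>a 1 n\<bar> + \<bar>a 2 n\<bar> + \<bar>a 3 n\<bar> + \<bar>a 4 n\<bar>) + 12 * spread q / 3 ^ n"
proof -
  have s: "{1..4} = {1,2,3,4::nat}" by auto
  have "\<bar>nodes g n k\<bar> \<le> \<bar>a 1 n\<bar> + \<bar>a 2 n\<bar> + \<bar>a 3 n\<bar> + \<bar>a 4 n\<bar>" if k: "k < 4" for k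
  proof -
    have "\<bar>nodes g n k\<bar> \<le> (\<Sum>j\<in>{1..4}. \<bar>a j n / eignorm j * eigvec (\<omega> (int n)) j k\<bar>)"
      by (subst coord_expansion[OF Theta_symbol[OF \<omega>, of "int n"] k]) (auto simp only: a_def intro!: sum_abs)
    also have "\<dots> \<le> (\<Sum>j\<in>{1..4}. \<bar>a j n\<bar>)"
    proof (rule sum_mono)
      fix j :: nat assume j: "j \<in> {1..4}"
      have "\<bar>eigvec (\<omega> (int n)) j k\<bar> \<le> eignorm j"
        using abs_eigvec_le[OF j Theta_symbol[OF \<omega>, of "int n"], of k] eignorm_ge[OF j] by linarith
      hence "\<bar>a j n\<bar> * \<bar>eigvec (\<omega> (int n)) j k\<bar> \<le> \<bar>a j n\<bar> * eignorm j"
        by (intro mult_left_mono) auto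
      thus "\<bar>a j n / eignorm j * eigvec (\<omega> (int n)) j k\<bar> \<le> \<bar>a j n\<bar>"
        using eignorm_ge[OF j] by (simp add: abs_mult field_simps)
    qed
    finally show ?thesis unfolding s by simp
  qed
  from bv_norm_pcoc_le[OF fg d this] show ?thesis by simp
qed

lemma lyap_trichotomy:
  assumes f: "f \<in> BV"
  shows "0 \<le> lyap family \<omega> f \<or> lyap family \<omega> f = ereal (ln mu) \<or> lyap family \<omega> f \<le> ereal (ln (1 / 3))"
proof -
  have fm: "f \<in> borel_measurable leb1" and "bv_var f < \<infinity>" using f unfolding BV_def by blast+
  \<comment> \<open>The infimum in \<open>bv_var\<close> supplies a representative of finite
    variation, whose point values at the nodes can be controlled.\<close>
  then obtain g where "AE x in leb1. g x = f x" and g: "circle_var g < \<infinity>"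
    unfolding bv_var_def INF_less_iff by blast
  hence fg: "AE x in leb1. f x = g x" by (auto elim: eventually_mono)
  obtain q where d: "dominates q g" using ex_dominates[OF g] by blast
  define a where "a j n = coord (\<omega> (int n)) j (nodes g n)" for j n
  note step = coord_nodes_step[OF d, folded a_def]
  note low = coord_le_bv_norm[OF fm fg d, folded a_def]
  show ?thesis
    unfolding lyap_def
  proof (rule growth_trichotomy[of "a 1" "12 * spread q" "a 2" _ "a 3" "1/3" "a 4" "(1 - sqrt 2) / 3"])
    show "\<bar>a 1 (Suc n) - 1 * a 1 n\<bar> \<le> 12 * spread q / 3 ^ n" for n
      using step[of 1 n] by (simp only: eigval_simps) simp
    show "\<bar>a 2 (Suc n) - mu * a 2 n\<bar> \<le> 12 * spread q / 3 ^ n" for n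
      using step[of 2 n] by (simp only: eigval_simps) simp
    show "\<bar>a 3 (Suc n) - 1 / 3 * a 3 n\<bar> \<le> 12 * spread q / 3 ^ n" for n
      using step[of 3 n] by (simp only: eigval_simps) simp
    show "\<bar>a 4 (Suc n) - (1 - sqrt 2) / 3 * a 4 n\<bar> \<le> 12 * spread q / 3 ^ n" for n
      using step[of 4 n] by (simp only: eigval_simps) simp
    show "bv_norm (pcoc family \<omega> n f) \<le> 8 * (\<bar>a 1 n\<bar> + \<bar>a 2 n\<bar> + \<bar>a 3 n\<bar> + \<bar>a 4 n\<bar>) + 12 * spread q / 3 ^ n" for n
      unfolding a_def by (rule bv_norm_le_coord[OF fg d])
    show "\<bar>a 1 n\<bar> \<le> 48 * bv_norm (pcoc family \<omega> n f) + 12 * spread q / 3 ^ n" for n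
      using low by simp
    show "\<bar>a 2 n\<bar> \<le> 48 * bv_norm (pcoc family \<omega> n f) + 12 * spread q / 3 ^ n" for n
      using low by simp
  qed (use mu_bounds abs_eigval_4 bv_norm_nonneg in auto)
qed

text \<open>The function is constant on quarters, so the zero majorant applies and the coordinate
  recurrences are exact. Only the second coordinate is nonzero, and each step multiplies it by
  \<open>mu\<close>.\<close>

lemma lyap_eigvec:
  defines "f \<equiv> vlift 4 quarter (eigvec (\<omega> 0) 2)"
  shows "f \<in> BV" "lyap family \<omega> f = ereal (ln mu)"
proof -
  have q: "quarter k \<in> sets leb1" if "k < 4" for k
    using quarter_subset[OF that] by (simp add: leb1_def sets_restrict_space_iff)
  have fm: "f \<in> borel_measurable leb1"
    unfolding f_def vlift_def using q
    by (intro borel_measurable_sum borel_measurable_times borel_measurable_const borel_measurable_indicator) auto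
  have fk: "f ((real k + u) / 4) = eigvec (\<omega> 0) 2 k" if "k < 4" "0 \<le> u" "u < 1" for k u
    unfolding f_def by (rule vlift_quarter[OF that])
  have d: "dominates (\<lambda>_ _. 0) f"
    unfolding dominates_def by (auto simp: fk)
  have sp: "spread (\<lambda>_ _. 0) = 0" by (simp add: spread_def)
  have K: "\<bar>f (real k / 4)\<bar> \<le> 3" if "k < 4" for k
    using fk[OF that, of 0] abs_eigvec_le[of 2 "\<omega> 0" k] Theta_symbol[OF \<omega>] by simp
  have "bv_var f \<le> circle_var f" unfolding bv_var_def by (rule INF_lower) simp
  also have "\<dots> \<le> ereal (8 * 3 + 12 * spread (\<lambda>_ _. 0))" by (rule circle_var_le[OF d K])
  finally have var: "bv_var f < \<infinity>" by (rule le_less_trans) simp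
  have "AE x in leb1. \<bar>f x\<bar> \<le> 3"
    using AE_space by eventually_elim (use dominates_bounded[OF d K] sp in auto)
  thus "f \<in> BV" using fm var by (auto simp: BV_def)
  define a where "a j n = coord (\<omega> (int n)) j (nodes f n)" for j n
  have a0: "a j 0 = (if j = 2 then eignorm 2 else 0)" if "j \<in> {1..4}" for j
  proof -
    have "a j 0 = coord (\<omega> 0) j (eigvec (\<omega> 0) 2)"
      unfolding a_def coord_def nodes_def using fk[of _ 0] by (intro sum.cong) auto
    thus ?thesis using coord_eigvec[OF Theta_symbol[OF \<omega>] that, of 2] by auto
  qed
  have an: "a j n = eigval j ^ n * a j 0" if "j \<in> {1..4}" for j n
  proof (induction n)
    case (Suc n)
    have "a j (Suc n) = eigval j * a j n"
      using coord_nodes_step[OF d that, of n] by (simp only: sp a_def)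
    thus ?case using Suc by simp
  qed simp
  have N2: "eignorm 2 > 0" using eignorm_ge[of 2] by simp
  have a2: "a 2 n = eignorm 2 * mu ^ n" for n using an[of 2 n] a0[of 2] by (simp add: eigval_simps)
  have a_other: "a 1 n = 0" "a 3 n = 0" "a 4 n = 0" for n
    using an[of 1 n] an[of 3 n] an[of 4 n] a0[of 1] a0[of 3] a0[of 4] by simp_all
  have mu0: "mu > 0" using mu_bounds(1) by linarith
  have fg: "AE x in leb1. f x = f x" by simp
  have "lyap family \<omega> f \<le> ereal (ln mu)"
    unfolding lyap_def
  proof (rule growth_le[OF bv_norm_nonneg])
    fix n
    have "bv_norm (pcoc family \<omega> n f) \<le> 8 * \<bar>a 2 n\<bar>"
      using bv_norm_le_coord[OF fg d, of n] unfolding a_def[symmetric] sp a_other by simp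
    also have "\<dots> = 8 * eignorm 2 * mu ^ n"
      using N2 mu0 by (simp only: a2 abs_mult power_abs abs_of_pos)
    also have "\<dots> \<le> 8 * eignorm 2 * (real n + 1) * mu ^ n"
      using N2 mu0 by (intro mult_right_mono) (auto simp: algebra_simps)
    finally show "bv_norm (pcoc family \<omega> n f) \<le> 8 * eignorm 2 * (real n + 1) * mu ^ n" .
  qed (use N2 mu0 in auto)
  moreover have "ereal (ln mu) \<le> lyap family \<omega> f"
    unfolding lyap_def
  proof (rule growth_ge[of "eignorm 2 / 48" _ 0])
    fix n
    have "\<bar>a 2 n\<bar> \<le> 48 * bv_norm (pcoc family \<omega> n f)"
      using coord_le_bv_norm[OF fm fg d, of 2 n] unfolding a_def[symmetric] sp by simp
    moreover have "\<bar>a 2 n\<bar> = eignorm 2 * mu ^ n"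
      using N2 mu0 by (simp only: a2 abs_mult power_abs abs_of_pos)
    ultimately show "eignorm 2 / 48 * mu ^ n - 0 * (real n + 1) / 3 ^ n \<le> bv_norm (pcoc family \<omega> n f)"
      by simp
  qed (use N2 mu_bounds in auto)
  ultimately show "lyap family \<omega> f = ereal (ln mu)" by (rule antisym)
qed

text \<open>The trichotomy leaves only \<open>ln mu\<close> strictly between
  \<open>ln (1 / 3)\<close> and 0, and \<open>lyap_eigvec\<close> attains it.\<close>

lemma exceptional_exponents_eq: "exceptional_exponents family \<omega> = {ereal (ln mu)}"
proof (intro equalityI subsetI)
  fix l assume "l \<in> exceptional_exponents family \<omega>"
  then obtain f where f: "f \<in> BV" "l = lyap family \<omega> f" and l: "ereal (ln (1 / 3)) < l" "l < 0"
    by (auto simp: exceptional_exponents_def lyap_spectrum_def ess_bound_eq)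
  show "l \<in> {ereal (ln mu)}"
    using lyap_trichotomy[OF f(1)] l unfolding f(2) by (auto simp: not_le[symmetric])
next
  fix l assume "l \<in> {ereal (ln mu)}"
  moreover have "0 < mu" using mu_bounds(1) by linarith
  hence "ln (1 / 3) < ln mu" "ln mu < 0" using mu_bounds by (simp_all only: ln_less_cancel_iff ln_less_zero)
  moreover have "ereal (ln mu) \<in> lyap_spectrum family \<omega>"
    unfolding lyap_spectrum_def using lyap_eigvec by force
  ultimately show "l \<in> exceptional_exponents family \<omega>"
    by (auto simp: exceptional_exponents_def ess_bound_eq)
qed

section \<open>Oseledets lines\<close>

lemma Amat_eigvec:
  assumes j: "j \<in> {1..4}"
  shows "Amat family 4 quarter (\<omega> (int n)) (\<lambda>k. c * eigvec (\<omega> (int n)) j k)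
    = (\<lambda>k. (c * eigval j) * eigvec (\<omega> (int (Suc n))) j k)"
proof -
  have v: "(\<lambda>k. c * eigvec (\<omega> (int n)) j k) \<in> vecs 4" by (simp add: vecs_def eigvec_def)
  have "transfer (tau (\<omega> (int n))) (\<lambda>k. c * eigvec (\<omega> (int n)) j k) k / 3
      = (c * eigval j) * eigvec (\<omega> (int (Suc n))) j k" if "k < 4" for k
    using transfer_eigvec[OF Theta_symbol[OF \<omega>] Theta_symbol[OF \<omega>] Theta_edge_nat[OF \<omega>] j that, of n]
    by (simp add: transfer_mult)
  moreover have "eigvec i j k = 0" if "\<not> k < 4" for i k using that by (simp add: eigvec_def)
  ultimately show ?thesis
    unfolding Amat_smap[where \<tau> = tau, OF bal v] by auto
qed

lemma Acoc_eigvec: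
  assumes j: "j \<in> {1..4}"
  shows "Acoc family 4 quarter \<omega> n (\<lambda>k. c * eigvec (\<omega> 0) j k) = (\<lambda>k. (c * eigval j ^ n) * eigvec (\<omega> (int n)) j k)"
proof (induction n)
  case (Suc n)
  show ?case unfolding Acoc.simps Suc.IH Amat_eigvec[OF j] by (simp add: mult_ac)
qed simp

lemma vnorm_eigvec:
  assumes j: "j \<in> {1..4}"
  shows "vnorm 4 (\<lambda>k. c * eigvec (\<omega> i) j k) = \<bar>c\<bar> * sqrt (eignorm j)"
proof -
  have "(\<Sum>k<4. (c * eigvec (\<omega> i) j k)\<^sup>2) = c\<^sup>2 * coord (\<omega> i) j (eigvec (\<omega> i) j)"
    by (simp add: coord_def sum_distrib_left power2_eq_square mult_ac)
  also have "coord (\<omega> i) j (eigvec (\<omega> i) j) = eignorm j"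
    using coord_eigvec[OF Theta_symbol[OF \<omega>] j j] by simp
  finally show ?thesis by (simp add: vnorm_def real_sqrt_mult)
qed

text \<open>Spanning is \<open>coord_expansion\<close>; independence follows by pairing a vanishing
  sum with each eigenvector in turn.\<close>

lemma direct_sum_eigvec: "direct_sum 4 4 (\<lambda>j. {\<lambda>k. c * eigvec (\<omega> 0) j k | c. True})"
  unfolding direct_sum_def
proof (intro conjI ballI allI impI)
  note i = Theta_symbol[OF \<omega>, of 0]
  fix j :: nat assume j: "j \<in> {1..4}"
  show "lin_subspace 4 {\<lambda>k. c * eigvec (\<omega> 0) j k | c. True}"
    unfolding lin_subspace_def
  proof (intro conjI ballI allI)
    show "{\<lambda>k. c * eigvec (\<omega> 0) j k | c. True} \<subseteq> vecs 4" by (auto simp: vecs_def eigvec_def)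
    show "(\<lambda>k. 0) \<in> {\<lambda>k. c * eigvec (\<omega> 0) j k | c. True}" by (auto intro!: exI[of _ 0])
  next
    fix v w assume "v \<in> {\<lambda>k. c * eigvec (\<omega> 0) j k | c. True}" "w \<in> {\<lambda>k. c * eigvec (\<omega> 0) j k | c. True}"
    then obtain c d where "v = (\<lambda>k. c * eigvec (\<omega> 0) j k)" "w = (\<lambda>k. d * eigvec (\<omega> 0) j k)" by blast
    thus "(\<lambda>k. v k + w k) \<in> {\<lambda>k. c * eigvec (\<omega> 0) j k | c. True}"
      by (auto intro!: exI[of _ "c + d"] simp: distrib_right)
  next
    fix b v assume "v \<in> {\<lambda>k. c * eigvec (\<omega> 0) j k | c. True}"
    then obtain c where "v = (\<lambda>k. c * eigvec (\<omega> 0) j k)" by blast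
    thus "(\<lambda>k. b * v k) \<in> {\<lambda>k. c * eigvec (\<omega> 0) j k | c. True}"
      by (auto intro!: exI[of _ "b * c"])
  qed
  have "coord (\<omega> 0) j (eigvec (\<omega> 0) j) \<noteq> 0"
    using coord_eigvec[OF i j j] eignorm_ge[OF j] by simp
  hence "eigvec (\<omega> 0) j \<noteq> (\<lambda>k. 0)" by (auto simp: coord_def)
  hence "(\<lambda>k. 1 * eigvec (\<omega> 0) j k) \<noteq> (\<lambda>k. 0)" by simp
  thus "{\<lambda>k. c * eigvec (\<omega> 0) j k | c. True} \<noteq> {\<lambda>k. 0}" by blast
next
  fix v :: "nat \<Rightarrow> real" assume v: "v \<in> vecs 4"
  let ?w = "\<lambda>j k. coord (\<omega> 0) j v / eignorm j * eigvec (\<omega> 0) j k"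
  have "v k = (\<Sum>j\<in>{1..4}. ?w j k)" for k
  proof (cases "k < 4")
    case True
    thus ?thesis by (rule coord_expansion[OF Theta_symbol[OF \<omega>]])
  next
    case False
    thus ?thesis using v by (simp add: vecs_def eigvec_def)
  qed
  thus "\<exists>w. (\<forall>j\<in>{1..4}. w j \<in> {\<lambda>k. c * eigvec (\<omega> 0) j k | c. True}) \<and> v = (\<lambda>k. \<Sum>j\<in>{1..4}. w j k)"
    by (intro exI[of _ ?w]) blast
next
  fix w :: "nat \<Rightarrow> nat \<Rightarrow> real" and l :: nat
  assume w: "(\<forall>j\<in>{1..4}. w j \<in> {\<lambda>k. c * eigvec (\<omega> 0) j k | c. True}) \<and> (\<lambda>k. \<Sum>j\<in>{1..4}. w j k) = (\<lambda>k. 0)"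
    and l: "l \<in> {1..4}"
  then obtain c where c: "\<And>j. j \<in> {1..4} \<Longrightarrow> w j = (\<lambda>k. c j * eigvec (\<omega> 0) j k)"
    by (auto simp: Bex_def dest!: bchoice)
  have "0 = (\<Sum>k<4. eigvec (\<omega> 0) l k * (\<Sum>j\<in>{1..4}. w j k))"
    using w by (simp add: fun_eq_iff)
  also have "\<dots> = (\<Sum>k<4. \<Sum>j\<in>{1..4}. c j * (eigvec (\<omega> 0) l k * eigvec (\<omega> 0) j k))"
    using c by (simp add: sum_distrib_left mult_ac)
  also have "\<dots> = (\<Sum>j\<in>{1..4}. c j * coord (\<omega> 0) l (eigvec (\<omega> 0) j))"
    by (subst sum.swap) (simp add: coord_def sum_distrib_left)
  also have "\<dots> = (\<Sum>j\<in>{1..4}. if j = l then c l * eignorm l else 0)"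
    using coord_eigvec[OF Theta_symbol[OF \<omega>] l] by (intro sum.cong) auto
  also have "\<dots> = c l * eignorm l" using l by simp
  finally have "c l = 0" using eignorm_ge[OF l] by simp
  thus "w l = (\<lambda>k. 0)" using c[OF l] by simp
qed

end

lemma eigval_nonzero: "j \<in> {1..4} \<Longrightarrow> eigval j \<noteq> 0"
  using sqrt2_bounds unfolding exponents by (elim disjE) (simp_all add: eigval_def)

text \<open>Moduli are needed because the fourth eigenvalue is negative; they order the four
  exponents.\<close>

lemma abs_eigval_decreasing: "j \<in> {1..<4} \<Longrightarrow> \<bar>eigval (Suc j)\<bar> < \<bar>eigval j\<bar>"
proof -
  assume "j \<in> {1..<4}"
  hence "j = 1 \<or> j = 2 \<or> j = 3" by auto
  thus ?thesis using sqrt2_bounds by (elim disjE) (simp_all add: eigval_def)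
qed

text \<open>The matrix carries each eigenline onto the corresponding line of the next symbol with a
  nonzero multiplier, so all four exponents are finite and invariance holds with equality.\<close>

lemma oseledets_eigvec:
  "oseledets_decomposition family 4 quarter (\<lambda>_. 4) (\<lambda>_ j. ereal (ln \<bar>eigval j\<bar>))
     (\<lambda>\<omega> j. {\<lambda>k. c * eigvec (\<omega> 0) j k | c. True})"
  unfolding oseledets_decomposition_def
proof (intro ballI conjI impI)
  fix \<omega> assume \<omega>: "\<omega> \<in> Theta"
  show "direct_sum 4 4 (\<lambda>j. {\<lambda>k. c * eigvec (\<omega> 0) j k | c. True})"
    by (rule direct_sum_eigvec[OF \<omega>])
  fix j :: nat
  {
    assume j: "j \<in> {1..<4}"
    have "eigval (Suc j) \<noteq> 0" by (rule eigval_nonzero) (use j in auto)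
    thus "ereal (ln \<bar>eigval (Suc j)\<bar>) < ereal (ln \<bar>eigval j\<bar>)"
      using abs_eigval_decreasing[OF j] by (simp add: ln_less_cancel_iff)
  next
    assume j: "j \<in> {1..4}"
    have A: "Amat family 4 quarter (\<omega> 0) (\<lambda>k. c * eigvec (\<omega> 0) j k) = (\<lambda>k. (c * eigval j) * eigvec (shift \<omega> 0) j k)" for c
      using Amat_eigvec[OF \<omega> j, of 0 c] by (simp add: shift_def)
    show eq: "Amat family 4 quarter (\<omega> 0) ` {\<lambda>k. c * eigvec (\<omega> 0) j k | c. True} = {\<lambda>k. c * eigvec (shift \<omega> 0) j k | c. True}"
    proof (intro equalityI subsetI)
      fix v assume "v \<in> Amat family 4 quarter (\<omega> 0) ` {\<lambda>k. c * eigvec (\<omega> 0) j k | c. True}"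
      thus "v \<in> {\<lambda>k. c * eigvec (shift \<omega> 0) j k | c. True}" using A by auto
    next
      fix v assume "v \<in> {\<lambda>k. c * eigvec (shift \<omega> 0) j k | c. True}"
      then obtain c where c: "v = (\<lambda>k. c * eigvec (shift \<omega> 0) j k)" by blast
      have "v = Amat family 4 quarter (\<omega> 0) (\<lambda>k. (c / eigval j) * eigvec (\<omega> 0) j k)"
        unfolding A c using eigval_nonzero[OF j] by simp
      thus "v \<in> Amat family 4 quarter (\<omega> 0) ` {\<lambda>k. c * eigvec (\<omega> 0) j k | c. True}" by blast
    qed
    thus "Amat family 4 quarter (\<omega> 0) ` {\<lambda>k. c * eigvec (\<omega> 0) j k | c. True} \<subseteq> {\<lambda>k. c * eigvec (shift \<omega> 0) j k | c. True}"
      by simp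
    fix v assume "v \<in> {\<lambda>k. c * eigvec (\<omega> 0) j k | c. True}" and v0: "v \<noteq> (\<lambda>k. 0)"
    then obtain c where c: "v = (\<lambda>k. c * eigvec (\<omega> 0) j k)" by blast
    have c0: "c \<noteq> 0" using v0 c by auto
    have "vnorm 4 (Acoc family 4 quarter \<omega> n v) = (\<bar>c\<bar> * sqrt (eignorm j)) * \<bar>eigval j\<bar> ^ n" for n
      unfolding c Acoc_eigvec[OF \<omega> j] vnorm_eigvec[OF \<omega> j] by (simp add: abs_mult power_abs)
    thus "(\<lambda>n. ereal (1 / real n) * eln (vnorm 4 (Acoc family 4 quarter \<omega> n v))) \<longlonglongrightarrow> ereal (ln \<bar>eigval j\<bar>)"
      using growth_tendsto[of "\<bar>c\<bar> * sqrt (eignorm j)" "\<bar>eigval j\<bar>"] c0 eigval_nonzero[OF j] eignorm_ge[OF j]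
      by simp
  }
qed simp

theorem theorem2:
  "\<exists>(S :: nat \<Rightarrow> real \<Rightarrow> real) (M :: nat) (B :: nat \<Rightarrow> real set).
     (\<forall>i\<in>{1..6}. pw_affine_expanding (S i)) \<and>
     (\<forall>i\<in>{1..6}. markov_partition (S i) M B) \<and>
     (\<forall>i\<in>{1..6}. preserves_leb (S i)) \<and>
     (\<forall>\<omega>\<in>Theta. ess_bound S \<omega> = ereal (ln (1 / 3))) \<and>
     (\<forall>i\<in>{1..6}. \<not> (\<exists>lam. exceptional_eigenvalue (S i) (chiB M B) lam)) \<and>
     (\<forall>\<omega>\<in>Theta. exceptional_exponents S \<omega> = {ereal (ln ((1 + sqrt 2) / 3))}) \<and>
     (\<exists>ell lam W. oseledets_decomposition S M B ell lam W \<and>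
        (\<forall>\<omega>\<in>Theta. ell \<omega> \<ge> 2) \<and>
        (\<forall>\<omega>\<in>Theta. \<forall>\<omega>'\<in>Theta. \<omega> 0 = \<omega>' 0 \<longrightarrow> W \<omega> 2 = W \<omega>' 2))"
proof (intro exI[of _ family] exI[of _ "4::nat"] exI[of _ quarter] conjI ballI)
  fix i :: nat assume i: "i \<in> {1..6}"
  show "pw_affine_expanding (family i)" by (rule smap_pw_affine_expanding[OF balanced_tau[OF i]])
  show "markov_partition (family i) 4 quarter" by (rule markov_partition_smap[OF balanced_tau[OF i]])
  show "preserves_leb (family i)" by (rule smap_preserves_leb[OF balanced_tau[OF i]])
  show "\<not> (\<exists>lam. exceptional_eigenvalue (family i) (chiB 4 quarter) lam)"
    using no_exceptional_eigenvalue[OF i] by blast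
next
  fix \<omega> assume \<omega>: "\<omega> \<in> Theta"
  show "ess_bound family \<omega> = ereal (ln (1 / 3))"
    by (rule smap_cocycle.ess_bound_eq[OF Theta_cocycle[OF \<omega>]])
  show "exceptional_exponents family \<omega> = {ereal (ln ((1 + sqrt 2) / 3))}"
    by (rule exceptional_exponents_eq[OF \<omega>])
next
  \<comment> \<open>The splitting of \<open>oseledets_eigvec\<close> mentions \<omega> only through
    \<open>\<omega> 0\<close>, so the claimed dependence is immediate.\<close>
  show "\<exists>ell lam W. oseledets_decomposition family 4 quarter ell lam W \<and>
        (\<forall>\<omega>\<in>Theta. ell \<omega> \<ge> 2) \<and>
        (\<forall>\<omega>\<in>Theta. \<forall>\<omega>'\<in>Theta. \<omega> 0 = \<omega>' 0 \<longrightarrow> W \<omega> 2 = W \<omega>' 2)"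
    by (rule exI, rule exI, rule exI, rule conjI, rule oseledets_eigvec) simp
qed

end
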